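(* Let $G$ be a nontrivial finite group. Then $\kappa(G)<5^3$ if and only if one of the following occurs: (a) $\omega(G)=\{1,2\}$ and $G$ is an elementary abelian $2$-group; (b) $\omega(G)=\{1,3\}$ and $G\cong\mathbb{Z}_3$ or $G\cong\mathbb{Z}_3\times\mathbb{Z}_3$; (c) $\omega(G)=\{1,2,3\}$ and $G\cong\mathbb{S}_3\cong\mathbb{Z}_3\rtimes\mathbb{Z}_2$, or $G\cong(\mathbb{Z}_3\times\mathbb{Z}_3)\rtimes\mathbb{Z}_2$ (some semidirect product), or $G\cong\mathbb{A}_4\cong(\mathbb{Z}_2\times\mathbb{Z}_2)\rtimes\mathbb{Z}_3$; (d) $\omega(G)=\{1,2,4\}$ and $G\cong\mathbb{Z}_4$ or $G\cong D_8$.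
   Context: For a finite group $G$, the power graph $\mathcal{P}(G)$ is the simple undirected graph whose vertices are the elements of $G$, two distinct vertices $x,y$ being adjacent iff $\langle x\rangle\subseteq\langle y\rangle$ or $\langle y\rangle\subseteq\langle x\rangle$. $\kappa(G)$ denotes the number of spanning trees of $\mathcal{P}(G)$. $\omega(G)$ denotes the set of orders of all elements of $G$. $\mathbb{S}_m$ and $\mathbb{A}_m$ are the symmetric and alternating groups of degree $m$, and $D_8$ is the dihedral group of order $8$. *)

theory Defs
  imports "HOL-Algebra.Algebra"
begin

section \<open>Simple graphs and spanning trees\<close>

text \<open>
  A simple undirected graph is a pair of a vertex set and an edge set, every edge being a
  two-element set of vertices.
\<close>

type_synonym 'a ugraph = "'a set \<times> 'a set set"

definition adj_rel :: "'a ugraph \<Rightarrow> ('a \<times> 'a) set" where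
  "adj_rel \<Gamma> = {(u, v). {u, v} \<in> snd \<Gamma>}"

definition connected_ugraph :: "'a ugraph \<Rightarrow> bool" where
  "connected_ugraph \<Gamma> \<longleftrightarrow>
     fst \<Gamma> \<noteq> {} \<and> (\<forall>u \<in> fst \<Gamma>. \<forall>v \<in> fst \<Gamma>. (u, v) \<in> (adj_rel \<Gamma>)\<^sup>*)"

text \<open>The list enumerates the distinct vertices of the cycle; its last vertex is joined to its first.\<close>

definition is_cycle :: "'a ugraph \<Rightarrow> 'a list \<Rightarrow> bool" where
  "is_cycle \<Gamma> c \<longleftrightarrow>
     3 \<le> length c \<and> distinct c \<and>
     (\<forall>i < length c. {c ! i, c ! (Suc i mod length c)} \<in> snd \<Gamma>)"

definition is_tree :: "'a ugraph \<Rightarrow> bool" where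
  "is_tree \<Gamma> \<longleftrightarrow> connected_ugraph \<Gamma> \<and> (\<nexists>c. is_cycle \<Gamma> c)"

definition spanning_trees :: "'a ugraph \<Rightarrow> 'a ugraph set" where
  "spanning_trees \<Gamma> = {T. fst T = fst \<Gamma> \<and> snd T \<subseteq> snd \<Gamma> \<and> is_tree T}"

section \<open>The power graph of a group\<close>

definition power_graph :: "('a, 'b) monoid_scheme \<Rightarrow> 'a ugraph" where
  "power_graph G =
     (carrier G,
      {{x, y} | x y. x \<in> carrier G \<and> y \<in> carrier G \<and> x \<noteq> y \<and>
         (generate G {x} \<subseteq> generate G {y} \<or> generate G {y} \<subseteq> generate G {x})})"

definition \<kappa> :: "('a, 'b) monoid_scheme \<Rightarrow> nat" where
  "\<kappa> G = card (spanning_trees (power_graph G))"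

definition \<omega> :: "('a, 'b) monoid_scheme \<Rightarrow> nat set" where
  "\<omega> G = group.ord G ` carrier G"

section \<open>The groups of the classification\<close>

definition elementary_abelian :: "nat \<Rightarrow> ('a, 'b) monoid_scheme \<Rightarrow> bool" where
  "elementary_abelian p G \<longleftrightarrow>
     Factorial_Ring.prime p \<and> comm_group G \<and>
     (\<forall>x \<in> carrier G. x \<noteq> \<one>\<^bsub>G\<^esub> \<longrightarrow> group.ord G x = p)"

definition semidirect_product ::
    "('a, 'c) monoid_scheme \<Rightarrow> ('b, 'd) monoid_scheme \<Rightarrow> ('b \<Rightarrow> 'a \<Rightarrow> 'a) \<Rightarrow> ('a \<times> 'b) monoid" where
  "semidirect_product N H \<phi> =
     \<lparr>carrier = carrier N \<times> carrier H,
      monoid.mult = (\<lambda>(n\<^sub>1, h\<^sub>1) (n\<^sub>2, h\<^sub>2). (n\<^sub>1 \<otimes>\<^bsub>N\<^esub> \<phi> h\<^sub>1 n\<^sub>2, h\<^sub>1 \<otimes>\<^bsub>H\<^esub> h\<^sub>2)),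
      one = (\<one>\<^bsub>N\<^esub>, \<one>\<^bsub>H\<^esub>)\<rparr>"

text \<open>
  \<open>is_semidirect_product G N H\<close> says that \<open>G\<close> is isomorphic to \<open>N \<rtimes> H\<close> for some action of
  \<open>H\<close> on \<open>N\<close> by automorphisms. The trivial action is allowed.
\<close>

definition is_semidirect_product ::
    "('g, 'e) monoid_scheme \<Rightarrow> ('a, 'c) monoid_scheme \<Rightarrow> ('b, 'd) monoid_scheme \<Rightarrow> bool" where
  "is_semidirect_product G N H \<longleftrightarrow>
     (\<exists>\<phi> \<in> hom H (AutoGroup N). G \<cong> semidirect_product N H \<phi>)"

text \<open>
  The dihedral group of order \<open>2 * n\<close> (for \<open>n \<ge> 1\<close>): rotations \<open>\<int>/n\<close> extended by a reflection
  that inverts them. Thus the group usually called \<open>D\<^sub>8\<close>, of order 8, is \<open>dihedral_group 4\<close>.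
\<close>

definition dihedral_group :: "nat \<Rightarrow> (int \<times> int) monoid" where
  "dihedral_group n =
     semidirect_product (integer_mod_group n) (integer_mod_group 2)
       (\<lambda>s. \<lambda>r \<in> carrier (integer_mod_group n).
          if s = 0 then r else inv\<^bsub>integer_mod_group n\<^esub> r)"

end

theory Submission
  imports Defs
begin

text \<open>
  The identity is adjacent to every vertex of the power graph, so a spanning tree of the subgraph
  induced on any set of elements containing the identity extends to a spanning tree of the whole
  graph, by hanging the remaining elements below the identity. Hence a few elements of
  inconvenient orders already force many spanning trees.
  An element of order at least 5 yields a complete graph on five vertices, with \<open>5\<^sup>3\<close> spanning
  trees (\<open>kappa_ge_of_ord_ge_5\<close>); two cyclic subgroups of order 4 yield at least 192
  (\<open>kappa_ge_two_cyclic_4\<close>); five subgroups of order 3 are five triangles with a common vertex and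
  yield \<open>3\<^sup>5\<close> (\<open>kappa_ge_five_cyclic_3\<close>). If \<open>\<kappa> G < 5\<^sup>3\<close>, then all orders are at most 4, there is at
  most one cyclic subgroup of order 4, and there are at most four subgroups of order 3.

  Groups of this kind are few. If there is a cyclic subgroup of order 4, then, being the only one, it
  is normal and an element of order 3 would centralise it and produce an element of order 12
  (\<open>exists_ord_ge_5_of_ord_3_4\<close>). So outside this subgroup all elements are involutions.
  The main tool is the following remark on a subgroup \<open>C\<close> whose complement consists of involutions:
  each \<open>t\<close> outside \<open>C\<close> inverts \<open>C\<close>, because \<open>tx\<close> is an involution again. Thus
  either \<open>C\<close> is the whole group, or \<open>C\<close> is abelian and, unless it has exponent 2, of index 2,
  so that the group is the semidirect product of \<open>C\<close> with a group of order 2 acting by inversion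
  (\<open>iso_of_involution_complement\<close>). For a cyclic subgroup of order 4 this gives \<open>\<int>/4\<close> and \<open>D\<^sub>8\<close>.

  If the orders are 1, 2 and 3, let \<open>C\<close> be the set of solutions of \<open>x\<^sup>3 = 1\<close>, which has at most nine
  elements. If these commute, then \<open>C\<close> is \<open>\<int>/3\<close> or \<open>\<int>/3 \<times> \<int>/3\<close>, and the remark applies.
  If \<open>a\<close> and \<open>b\<close> in \<open>C\<close> do not commute, then \<open>C\<close> consists of the powers of \<open>a\<close> and the conjugates of
  \<open>b\<close> and its inverse under these powers, and comparing \<open>ab\<close> with this list shows that \<open>ab\<close> or \<open>a\<^sup>-\<^sup>1b\<close> is
  an involution (\<open>exists_alt4_generators\<close>). These are the relations of the alternating group of degree 4
  (\<open>alt4_presentation_embedding\<close>), and the remark, applied to the non-abelian subgroup generated by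
  \<open>a\<close> and \<open>b\<close>, shows that it is the whole group.

  Conversely, in the listed groups every edge of the power graph is a pendant edge at the identity, or
  belongs to one of at most four triangles, or to a single complete graph on four vertices. This bounds the
  number of spanning trees by \<open>3\<^sup>4\<close> or by \<open>2\<^sup>6\<close>
  (\<open>kappa_le_of_orders_123\<close>, \<open>kappa_le_of_orders_124\<close>).
\<close>

section \<open>Spanning trees from parent functions\<close>

definition parent_edges :: "'a set \<Rightarrow> 'a \<Rightarrow> ('a \<Rightarrow> 'a) \<Rightarrow> 'a set set" where
  "parent_edges V r p = (\<lambda>v. {v, p v}) ` (V - {r})"

text \<open>
  Following parents decreases the depth \<open>d\<close>, hence leads to the root; and a cycle is impossible at its
  deepest vertex.
\<close>

lemma is_tree_parent_edges:
  fixes d :: "'a \<Rightarrow> nat"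
  assumes r: "r \<in> V" and p: "\<And>v. v \<in> V - {r} \<Longrightarrow> p v \<in> V \<and> d (p v) < d v"
  shows "is_tree (V, parent_edges V r p)"
proof -
  let ?T = "(V, parent_edges V r p)"
  have sym: "sym (adj_rel ?T)"
    by (auto simp: adj_rel_def sym_def insert_commute)
  have reach: "(v, r) \<in> (adj_rel ?T)\<^sup>*" if "v \<in> V" for v
    using that
  proof (induction "d v" arbitrary: v rule: less_induct)
    case less
    show ?case
    proof (cases "v = r")
      case False
      with less.prems p have "p v \<in> V" "d (p v) < d v" by auto
      with less.hyps have "(p v, r) \<in> (adj_rel ?T)\<^sup>*" by blast
      moreover have "(v, p v) \<in> adj_rel ?T"
        using False less.prems by (auto simp: adj_rel_def parent_edges_def)
      ultimately show ?thesis by (meson converse_rtrancl_into_rtrancl)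
    qed simp
  qed
  have conn: "connected_ugraph ?T"
    unfolding connected_ugraph_def
  proof (intro conjI ballI)
    fix u v assume "u \<in> fst ?T" "v \<in> fst ?T"
    then have "(u, r) \<in> (adj_rel ?T)\<^sup>*" "(r, v) \<in> (adj_rel ?T)\<^sup>*"
      using reach[of u] reach[of v] sym_rtrancl[OF sym] by (auto simp: sym_def)
    then show "(u, v) \<in> (adj_rel ?T)\<^sup>*" by (rule rtrancl_trans)
  qed (use r in auto)
  have parent: "w = p u" if "{u, w} \<in> parent_edges V r p" "u \<noteq> w" "d w \<le> d u" for u w
    using that p by (fastforce simp: parent_edges_def doubleton_eq_iff)
  have "\<not> is_cycle ?T c" for c
  proof
    assume c: "is_cycle ?T c"
    define n where "n = length c"
    have n: "3 \<le> n" and dist: "distinct c"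
      and e: "\<And>i. i < n \<Longrightarrow> {c ! i, c ! (Suc i mod n)} \<in> parent_edges V r p"
      using c by (auto simp: is_cycle_def n_def)
    \<comment> \<open>Both neighbours of a cycle vertex of maximal depth would have to be its parent.\<close>
    have "\<exists>i\<in>{..<n}. \<forall>j\<in>{..<n}. d (c ! j) \<le> d (c ! i)"
    proof -
      have fin: "finite ((\<lambda>i. d (c ! i)) ` {..<n})" and ne: "(\<lambda>i. d (c ! i)) ` {..<n} \<noteq> {}"
        using n by (auto simp: lessThan_empty_iff)
      from Max_in[OF this] obtain i where "i < n" "Max ((\<lambda>i. d (c ! i)) ` {..<n}) = d (c ! i)"
        by auto
      then show ?thesis using Max_ge[OF fin] by (intro bexI[of _ i]) auto
    qed
    then obtain i where i: "i < n" and max: "\<And>j. j < n \<Longrightarrow> d (c ! j) \<le> d (c ! i)" by auto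
    define s where "s = Suc i mod n"
    define t where "t = (if i = 0 then n - 1 else i - 1)"
    have s: "s < n" "s \<noteq> i" and t: "t < n" "t \<noteq> i" "Suc t mod n = i" and "s \<noteq> t"
      using n i by (auto simp: s_def t_def mod_Suc)
    have "c ! s = p (c ! i)"
      using e[OF i] max[OF s(1)] s i dist by (intro parent) (auto simp: s_def n_def nth_eq_iff_index_eq)
    moreover have "c ! t = p (c ! i)"
      using e[OF t(1)] max[OF t(1)] t i dist
      by (intro parent) (auto simp: n_def nth_eq_iff_index_eq insert_commute)
    ultimately show False
      using \<open>s \<noteq> t\<close> s t dist nth_eq_iff_index_eq[OF dist, of s t] by (simp add: n_def)
  qed
  with conn show ?thesis by (simp add: is_tree_def)
qed

text \<open>
  If \<open>p v \<noteq> q v\<close>, then the edge from \<open>v\<close> to \<open>p v\<close> belongs to the second family only as the edge from \<open>p v\<close>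
  to its parent \<open>v\<close>. By induction \<open>p\<close> and \<open>q\<close> agree at \<open>p v\<close>, so \<open>p\<close> would lead from \<open>v\<close> back to \<open>v\<close>.
\<close>

lemma parent_edges_inject:
  fixes d d' :: "'a \<Rightarrow> nat"
  assumes p: "\<And>v. v \<in> V - {r} \<Longrightarrow> p v \<in> V \<and> d (p v) < d v"
    and eq: "parent_edges V r p = parent_edges V r q" and v: "v \<in> V - {r}"
  shows "p v = q v"
  using v
proof (induction "d v" arbitrary: v rule: less_induct)
  case less
  show ?case
  proof (rule ccontr)
    assume ne: "p v \<noteq> q v"
    have "{v, p v} \<in> parent_edges V r q"
      using less.prems unfolding eq[symmetric] by (auto simp: parent_edges_def)
    with ne have flip: "q (p v) = v" "p v \<in> V - {r}"
      by (auto simp: parent_edges_def doubleton_eq_iff)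
    moreover have "d (p v) < d v" using p less.prems by blast
    ultimately have "p (p v) = v" using less.hyps by metis
    then show False using p[OF flip(2)] \<open>d (p v) < d v\<close> by simp
  qed
qed

text \<open>
  Adjacency in the power graph, except that an element is also linked to itself.
\<close>

definition linked :: "('a, 'b) monoid_scheme \<Rightarrow> 'a \<Rightarrow> 'a \<Rightarrow> bool" where
  "linked G x y \<longleftrightarrow> generate G {x} \<subseteq> generate G {y} \<or> generate G {y} \<subseteq> generate G {x}"

lemma linked_sym: "linked G x y \<Longrightarrow> linked G y x"
  by (auto simp: linked_def)

lemma power_graph_edge_iff:
  "{x, y} \<in> snd (power_graph G) \<longleftrightarrow>
     x \<in> carrier G \<and> y \<in> carrier G \<and> x \<noteq> y \<and> linked G x y"
  by (auto simp: power_graph_def linked_def doubleton_eq_iff)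

lemma finite_spanning_trees:
  assumes "finite (snd \<Gamma>)" shows "finite (spanning_trees \<Gamma>)"
proof (rule finite_subset)
  show "spanning_trees \<Gamma> \<subseteq> {fst \<Gamma>} \<times> Pow (snd \<Gamma>)"
    by (auto simp: spanning_trees_def mem_Times_iff)
qed (use assms in auto)

lemma finite_power_graph_edges:
  assumes "finite (carrier G)" shows "finite (snd (power_graph G))"
  by (rule finite_subset[of _ "Pow (carrier G)"]) (use assms in \<open>auto simp: power_graph_def\<close>)

lemma (in group) linked_int_pow:
  assumes "x \<in> carrier G" shows "linked G x (x [^] (k::int))"
proof -
  have "x [^] k \<in> generate G {x}" unfolding generate_pow[OF assms] by blast
  then have "generate G {x [^] k} \<subseteq> generate G {x}"
    using assms by (intro generate_subgroup_incl generate_is_subgroup) auto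
  then show ?thesis by (simp add: linked_def)
qed

lemma (in group) generate_inv:
  assumes "x \<in> carrier G" shows "generate G {inv x} = generate G {x}"
proof -
  have "generate G {inv y} \<subseteq> generate G {y}" if "y \<in> carrier G" for y
    using that by (intro generate_subgroup_incl generate_is_subgroup) (auto intro: generate.intros)
  from this[of x] this[of "inv x"] show ?thesis using assms by auto
qed

lemma (in group) linked_inv: "x \<in> carrier G \<Longrightarrow> linked G (inv x) y \<longleftrightarrow> linked G x y"
  "y \<in> carrier G \<Longrightarrow> linked G x (inv y) \<longleftrightarrow> linked G x y"
  by (simp_all add: linked_def generate_inv)

lemma linked_refl: "linked G x x"
  by (simp add: linked_def)

lemma (in group) linked_one: "x \<in> carrier G \<Longrightarrow> linked G x \<one>"
  using linked_int_pow[of x 0] by simp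

lemma (in group) linked_one': "x \<in> carrier G \<Longrightarrow> linked G \<one> x"
  using linked_one linked_sym by metis

text \<open>
  The spanning trees of a graph, rooted at a fixed vertex, correspond to the parent functions along which
  one descends to the root. Counting spanning trees from below thus amounts to exhibiting parent functions.
\<close>

lemma (in group) kappa_ge_parent_functions:
  fixes P :: "'i \<Rightarrow> 'a \<Rightarrow> 'a" and d :: "'i \<Rightarrow> 'a \<Rightarrow> nat"
  assumes fin: "finite (carrier G)"
    and P: "\<And>c v. c \<in> A \<Longrightarrow> v \<in> carrier G - {\<one>} \<Longrightarrow>
      P c v \<in> carrier G \<and> d c (P c v) < d c v \<and> linked G (P c v) v"
    and inj: "\<And>c c'. c \<in> A \<Longrightarrow> c' \<in> A \<Longrightarrow> \<forall>v \<in> carrier G - {\<one>}. P c v = P c' v \<Longrightarrow> c = c'"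
  shows "card A \<le> \<kappa> G"
proof -
  define T where "T c = (carrier G, parent_edges (carrier G) \<one> (P c))" for c
  have "T c \<in> spanning_trees (power_graph G)" if c: "c \<in> A" for c
  proof -
    have "is_tree (T c)"
      unfolding T_def using P[OF c] by (intro is_tree_parent_edges[where d = "d c"]) auto
    moreover have "{v, P c v} \<in> snd (power_graph G)" if "v \<in> carrier G - {\<one>}" for v
      using P[OF c that] that linked_sym by (force simp: power_graph_edge_iff)
    ultimately show ?thesis
      by (auto simp: spanning_trees_def T_def power_graph_def parent_edges_def)
  qed
  moreover have "inj_on T A"
  proof
    fix c c' assume c: "c \<in> A" "c' \<in> A" and eq: "T c = T c'"
    have "P c v = P c' v" if v: "v \<in> carrier G - {\<one>}" for v
      using P[OF c(1)] eq
      by (intro parent_edges_inject[where d = "d c", OF _ _ v]) (auto simp: T_def)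
    then show "c = c'" using inj c by blast
  qed
  moreover have "finite (spanning_trees (power_graph G))"
    by (intro finite_spanning_trees finite_power_graph_edges fin)
  ultimately show ?thesis
    unfolding \<kappa>_def by (metis card_inj_on_le image_subsetI)
qed

text \<open>
  For explicit small graphs the vertices are numbered with the root as \<open>0\<close>, and a parent function becomes
  the list \<open>ps\<close> of the parents, the root being its own parent. The entry \<open>nbs ! i\<close> is the list of
  parents allowed for vertex \<open>i\<close>. Bounding the number of steps to the root by \<open>m\<close> makes the lists of
  parents that belong to trees computable by rewriting.
\<close>

fun descends :: "nat \<Rightarrow> nat list \<Rightarrow> nat \<Rightarrow> bool" where
  "descends m ps 0 = True"
| "descends 0 ps (Suc i) = False"
| "descends (Suc m) ps (Suc i) = descends m ps (ps ! Suc i)"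

definition parent_lists :: "nat \<Rightarrow> nat list list \<Rightarrow> nat list list" where
  "parent_lists m nbs = filter (\<lambda>ps. list_all (descends m ps) ps) (product_lists nbs)"

lemma descends_imp_funpow: "descends m ps i \<Longrightarrow> \<exists>n. ((!) ps ^^ n) i = 0"
proof (induction m ps i rule: descends.induct)
  case (1 m ps)
  show ?case by (rule exI[of _ 0]) simp
next
  case (3 m ps i)
  then obtain n where "((!) ps ^^ n) (ps ! Suc i) = 0" by auto
  then show ?case by (intro exI[of _ "Suc n"]) (simp add: funpow_swap1)
qed simp

text \<open>
  A lower bound by the trees on the listed elements: any other element is hung below the identity.
\<close>

lemma (in group) kappa_ge_parent_lists:
  assumes fin: "finite (carrier G)"
    and xs: "distinct xs" "set xs \<subseteq> carrier G" "xs \<noteq> []" "hd xs = \<one>"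
    and nbs: "list_all2 (\<lambda>x js. \<forall>j \<in> set js. j < length xs \<and> linked G (xs ! j) x) xs nbs"
    and root: "hd nbs = [0]" and dist: "list_all distinct nbs"
  shows "length (parent_lists m nbs) \<le> \<kappa> G"
proof -
  define k where "k = length xs"
  have len: "length nbs = k" using nbs by (simp add: list_all2_lengthD k_def)
  define idx where "idx = the_inv_into {..<k} ((!) xs)"
  have idx: "idx (xs ! i) = i" if "i < k" for i
    using that xs(1) by (auto simp: idx_def k_def inj_on_nth intro!: the_inv_into_f_f)
  have idx': "xs ! idx v = v" "idx v < k" if "v \<in> set xs" for v
    using that idx by (auto simp: in_set_conv_nth k_def)
  have k0: "k > 0" and xs0: "xs ! 0 = \<one>" using xs(3,4) by (auto simp: k_def hd_conv_nth)
  define P where "P ps v = (if v \<in> set xs then xs ! (ps ! idx v) else \<one>)" for ps v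
  define rank where "rank ps i = (LEAST n. ((!) ps ^^ n) i = 0)" for ps :: "nat list" and i
  \<comment> \<open>Elements off the list hang directly below the root, whose own depth is 0.\<close>
  define d where "d ps v = (if v \<in> set xs then rank ps (idx v) else 1)" for ps v
  have ps_ok: "length ps = k" "ps ! 0 = 0" "\<And>i. i < k \<Longrightarrow> ps ! i < k"
    "\<And>i. i < k \<Longrightarrow> linked G (xs ! (ps ! i)) (xs ! i)"
    "\<And>i. i < k \<Longrightarrow> i \<noteq> 0 \<Longrightarrow> rank ps (ps ! i) < rank ps i"
    if "ps \<in> set (parent_lists m nbs)" for ps
  proof -
    have valid: "\<forall>i \<in> set ps. descends m ps i" and pr: "list_all2 (\<lambda>x ys. x \<in> set ys) ps nbs"
      using that by (auto simp: parent_lists_def product_lists_set list_all_iff)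
    show l: "length ps = k" using pr len by (simp add: list_all2_lengthD)
    show "ps ! i < k" "linked G (xs ! (ps ! i)) (xs ! i)" if "i < k" for i
      using pr nbs that by (auto simp: list_all2_conv_all_nth k_def)
    show "ps ! 0 = 0"
      using list_all2_nthD2[OF pr, of 0] root len k0 by (cases nbs) auto
    show "rank ps (ps ! i) < rank ps i" if i: "i < k" "i \<noteq> 0" for i
    proof -
      have "descends m ps (ps ! i)" using valid i l by simp
      from descends_imp_funpow[OF this] obtain n where "((!) ps ^^ Suc n) i = 0"
        by (auto simp: funpow_swap1)
      then have r: "((!) ps ^^ rank ps i) i = 0" unfolding rank_def by (rule LeastI)
      with i obtain n where n: "rank ps i = Suc n" by (cases "rank ps i") auto
      have "((!) ps ^^ n) (ps ! i) = 0" using r by (simp add: n funpow_swap1)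
      then have "rank ps (ps ! i) \<le> n" unfolding rank_def by (rule Least_le)
      then show ?thesis by (simp add: n)
    qed
  qed
  have "length (parent_lists m nbs) = card (set (parent_lists m nbs))"
    using dist unfolding parent_lists_def
    by (intro distinct_card[symmetric] distinct_filter distinct_product_lists) (simp add: list_all_iff)
  also have "\<dots> \<le> \<kappa> G"
  proof (rule kappa_ge_parent_functions[where P = P and d = d, OF fin])
    fix ps v assume ps: "ps \<in> set (parent_lists m nbs)" and v: "v \<in> carrier G - {\<one>}"
    have "rank ps 0 = 0" unfolding rank_def by (rule Least_equality) auto
    then have d1: "d ps \<one> = 0" using idx[OF k0] xs0 k0 by (metis d_def k_def nth_mem)
    show "P ps v \<in> carrier G \<and> d ps (P ps v) < d ps v \<and> linked G (P ps v) v"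
    proof (cases "v \<in> set xs")
      case True
      then have i: "idx v < k" "xs ! idx v = v" using idx' by auto
      have "idx v \<noteq> 0" using i v xs0 by (metis DiffE insertI1)
      then show ?thesis
        using ps_ok(3-5)[OF ps i(1)] True xs(2) idx i by (auto simp: P_def d_def k_def)
    next
      case False
      then show ?thesis using v d1 linked_one'[of v] by (auto simp: P_def d_def)
    qed
  next
    fix ps qs assume ps: "ps \<in> set (parent_lists m nbs)" and qs: "qs \<in> set (parent_lists m nbs)"
      and eq: "\<forall>v \<in> carrier G - {\<one>}. P ps v = P qs v"
    show "ps = qs"
    proof (rule nth_equalityI)
      show "length ps = length qs" using ps_ok(1) ps qs by simp
      fix i assume "i < length ps"
      then have i: "i < k" using ps_ok(1) ps by simp
      show "ps ! i = qs ! i"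
      proof (cases "i = 0")
        case True
        then show ?thesis using ps_ok(2) ps qs by simp
      next
        case False
        have "xs ! i \<in> carrier G - {\<one>}"
          using False i xs xs0 k0 nth_mem[of i xs] nth_eq_iff_index_eq[OF xs(1), of i 0]
          by (auto simp: k_def)
        with eq have "P ps (xs ! i) = P qs (xs ! i)" by blast
        then have "xs ! (ps ! i) = xs ! (qs ! i)"
          using i idx[OF i] by (simp add: P_def k_def)
        then show ?thesis
          using ps_ok(3) ps qs i xs(1) by (simp add: k_def nth_eq_iff_index_eq)
      qed
    qed
  qed
  finally show ?thesis .
qed

section \<open>Many spanning trees\<close>

context group
begin

lemma exists_inverse_transversal:
  assumes "finite S" "S \<subseteq> carrier G" "\<And>x. x \<in> S \<Longrightarrow> inv x \<in> S \<and> inv x \<noteq> x"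
  shows "\<exists>Y. S = Y \<union> m_inv G ` Y \<and> Y \<inter> m_inv G ` Y = {} \<and> card S = 2 * card Y"
  using assms
proof (induction "card S" arbitrary: S rule: less_induct)
  case less
  show ?case
  proof (cases "S = {}")
    case True
    then show ?thesis by (intro exI[of _ "{}"]) simp
  next
    case False
    then obtain x where x: "x \<in> S" by blast
    define S' where "S' = S - {x, inv x}"
    have x': "x \<in> carrier G" "inv x \<in> S" "inv x \<noteq> x" using x less.prems by auto
    have S: "S = insert x (insert (inv x) S')" using x x' by (auto simp: S'_def)
    have notin: "x \<notin> S'" "inv x \<notin> S'" and "finite S'"
      using less.prems(1) by (auto simp: S'_def)
    then have card: "card S = card S' + 2"
      unfolding S using x' by simp
    have "\<And>y. y \<in> S' \<Longrightarrow> inv y \<in> S' \<and> inv y \<noteq> y"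
    proof -
      fix y assume "y \<in> S'"
      then have y: "y \<in> S" "y \<noteq> x" "y \<noteq> inv x" "y \<in> carrier G"
        using less.prems(2) by (auto simp: S'_def)
      then have "inv y \<noteq> x" "inv y \<noteq> inv x" using inv_inv[OF y(4)] x'(1) by auto
      then show "inv y \<in> S' \<and> inv y \<noteq> y"
        using less.prems(3)[OF y(1)] by (simp add: S'_def)
    qed
    then obtain Y where Y: "S' = Y \<union> m_inv G ` Y" "Y \<inter> m_inv G ` Y = {}" "card S' = 2 * card Y"
      using less.hyps[of S'] card less.prems(1,2) \<open>finite S'\<close> S by auto
    show ?thesis
    proof (intro exI[of _ "insert x Y"] conjI)
      show "S = insert x Y \<union> m_inv G ` insert x Y" using S Y(1) by auto
      show "insert x Y \<inter> m_inv G ` insert x Y = {}" using Y x' notin by auto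
      have "finite Y" using Y(1) less.prems(1) by (metis S'_def finite_Diff finite_Un)
      then show "card S = 2 * card (insert x Y)" using card Y notin by simp
    qed
  qed
qed

lemma one_eq_inv_iff: "x \<in> carrier G \<Longrightarrow> \<one> = inv x \<longleftrightarrow> x = \<one>"
  using inv_eq_1_iff[of x] by metis

text \<open>
  Each \<open>y\<close> in \<open>Y\<close> forms a triangle with its inverse and the identity. A spanning tree of this triangle
  either joins both elements to the identity, encoded by \<open>f y = \<one>\<close>, or hangs one of them, namely \<open>f y\<close>,
  below the other one. The choices for different \<open>y\<close> are independent.
\<close>

lemma kappa_ge_triangles:
  assumes fin: "finite (carrier G)" and Y: "Y \<subseteq> carrier G" "Y \<inter> m_inv G ` Y = {}"
  shows "3 ^ card Y \<le> \<kappa> G"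
proof -
  have inv_notin: "inv y \<notin> Y" "inv y \<noteq> y" if "y \<in> Y" for y
    using Y(2) that by (metis IntI empty_iff imageI)+
  have "\<one> \<notin> Y" using inv_notin(2)[of \<one>] by auto
  define P where "P f v = (if v \<in> f ` Y then inv v else \<one>)" for f :: "'a \<Rightarrow> 'a" and v
  define d :: "('a \<Rightarrow> 'a) \<Rightarrow> 'a \<Rightarrow> nat"
    where "d f v = (if v = \<one> then 0 else if v \<in> f ` Y then 2 else 1)" for f v
  define F where "F = (\<Pi>\<^sub>E y\<in>Y. {\<one>, y, inv y})"
  have mem: "y \<in> f ` Y \<longleftrightarrow> f y = y" "inv y \<in> f ` Y \<longleftrightarrow> f y = inv y"
    if f: "f \<in> F" and y: "y \<in> Y" for f y
  proof -
    have *: "z = y" if "z \<in> Y" "f z = y \<or> f z = inv y" for z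
    proof -
      have c: "y \<in> carrier G" "z \<in> carrier G" using y that Y(1) by auto
      have "f z \<in> {\<one>, z, inv z}" using f that by (auto simp: F_def)
      moreover have "f z \<noteq> \<one>" using that(2) y \<open>\<one> \<notin> Y\<close> c by (auto simp: inv_eq_1_iff)
      moreover have "z \<noteq> inv y" "y \<noteq> inv z" using inv_notin(1) y that(1) by auto
      ultimately show ?thesis using that(2) c by auto
    qed
    then show "y \<in> f ` Y \<longleftrightarrow> f y = y" "inv y \<in> f ` Y \<longleftrightarrow> f y = inv y"
      using y by (metis imageE imageI)+
  qed
  have "finite Y" using Y(1) fin finite_subset by blast
  moreover have "card {\<one>, y, inv y} = 3" if "y \<in> Y" for y
  proof -
    have "y \<in> carrier G" "y \<noteq> \<one>" "inv y \<noteq> y" using that \<open>\<one> \<notin> Y\<close> inv_notin(2) Y(1) by auto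
    then have "distinct [\<one>, y, inv y]" by (simp add: one_eq_inv_iff)
    from distinct_card[OF this] show ?thesis by simp
  qed
  ultimately have "3 ^ card Y = card F" unfolding F_def by (simp add: card_PiE)
  also have "\<dots> \<le> \<kappa> G"
  proof (rule kappa_ge_parent_functions[where P = P and d = d, OF fin])
    fix f v assume f: "f \<in> F" and v: "v \<in> carrier G - {\<one>}"
    have "inv v \<notin> f ` Y" if "v \<in> f ` Y"
    proof -
      from that obtain y where "y \<in> Y" "v = f y" by blast
      moreover from this have "f y \<in> {\<one>, y, inv y}" using f by (auto simp: F_def)
      ultimately have y: "y \<in> Y" "v = y \<or> v = inv y" using v by auto
      then show ?thesis using mem[OF f y(1)] inv_notin[OF y(1)] Y(1) that by (metis inv_inv subsetD)
    qed
    then show "P f v \<in> carrier G \<and> d f (P f v) < d f v \<and> linked G (P f v) v"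
      using v linked_one'[of v] linked_inv(1)[of v v] linked_refl[of G v] by (auto simp: P_def d_def inv_eq_1_iff)
  next
    fix f g assume fg: "f \<in> F" "g \<in> F" and eq: "\<forall>v \<in> carrier G - {\<one>}. P f v = P g v"
    have iff: "v \<in> f ` Y \<longleftrightarrow> v \<in> g ` Y" if "v \<in> carrier G - {\<one>}" for v
      using bspec[OF eq that] that by (auto simp: P_def inv_eq_1_iff one_eq_inv_iff split: if_splits)
    show "f = g"
    proof (rule PiE_ext[OF fg[unfolded F_def]])
      fix y assume y: "y \<in> Y"
      then have "y \<in> carrier G - {\<one>}" "inv y \<in> carrier G - {\<one>}"
        using Y(1) \<open>\<one> \<notin> Y\<close> by (auto simp: inv_eq_1_iff)
      then have "f y = y \<longleftrightarrow> g y = y" "f y = inv y \<longleftrightarrow> g y = inv y"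
        using iff mem[OF fg(1) y] mem[OF fg(2) y] by auto
      moreover have "f y \<in> {\<one>, y, inv y}" "g y \<in> {\<one>, y, inv y}"
        using fg y by (auto simp: F_def)
      ultimately show "f y = g y" by auto
    qed
  qed
  finally show ?thesis .
qed

text \<open>
  The elements \<open>1, x, x\<^sup>-\<^sup>1, x\<^sup>2, x\<^sup>-\<^sup>2\<close> form a complete graph: \<open>x\<close> and its inverse generate all of them, and
  \<open>x\<^sup>2\<close> and its inverse generate the same subgroup. The bound on the order makes them distinct.
\<close>

lemma kappa_ge_of_ord_ge_5:
  assumes fin: "finite (carrier G)" and x: "x \<in> carrier G" and ord: "5 \<le> ord x"
  shows "125 \<le> \<kappa> G"
proof -
  define g where "g i = x [^] (i::int)" for i
  have g_closed: "g i \<in> carrier G" for i using x by (simp add: g_def)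
  have g_eq: "g i = g j \<longleftrightarrow> i = j" if "\<bar>j - i\<bar> < 5" for i j
  proof -
    have "int (ord x) dvd j - i \<Longrightarrow> i = j"
      using that ord dvd_imp_le_int[of "j - i" "int (ord x)"] by (cases "i = j") auto
    then show ?thesis using int_pow_eq[OF x] by (auto simp: g_def)
  qed
  have g0: "g 0 = \<one>" and g_neg: "g (-1) = inv g 1" "g (-2) = inv g 2"
    using x by (simp_all add: g_def int_pow_neg)
  have "linked G (g 1) (g 2)"
    using linked_int_pow[OF x, of 2] x by (simp add: g_def)
  then have l: "linked G (g i) (g j)" if "i \<in> {0, 1, -1, 2, -2}" "j \<in> {0, 1, -1, 2, -2}" for i j
    using that linked_sym[of G "g 1" "g 2"] g_closed
    by (auto simp: g0 g_neg linked_inv linked_refl linked_one linked_one')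
  let ?xs = "[g 0, g 1, g (-1), g 2, g (-2)]"
  let ?nbs = "[[0], [0,2,3,4], [0,1,3,4], [0,1,2,4], [0,1,2,3]]"
  have "distinct ?xs"
    by (simp add: g_eq)
  moreover have "list_all2 (\<lambda>x js. \<forall>j \<in> set js. j < length ?xs \<and> linked G (?xs ! j) x) ?xs ?nbs"
    by (auto intro: l)
  ultimately have "length (parent_lists 3 ?nbs) \<le> \<kappa> G"
    using g_closed g0 by (intro kappa_ge_parent_lists[OF fin, of ?xs]) auto
  moreover have "length (parent_lists 3 ?nbs) = 125" by code_simp
  ultimately show ?thesis by simp
qed

lemma inv_ne_of_ord_gt_2:
  assumes "x \<in> carrier G" "2 < ord x" shows "inv x \<noteq> x"
proof
  assume "inv x = x"
  then have "x [^] (2::nat) = \<one>" using assms r_inv[of x] by (simp add: numeral_2_eq_2)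
  then show False using assms pow_eq_id[of x 2] dvd_imp_le[of "ord x" 2] by simp
qed

lemma exists_transversal_of_order:
  assumes fin: "finite (carrier G)" and n: "2 < n"
  defines "S \<equiv> {x \<in> carrier G. ord x = n}"
  shows "\<exists>Y. S = Y \<union> m_inv G ` Y \<and> Y \<inter> m_inv G ` Y = {} \<and> card S = 2 * card Y"
  by (rule exists_inverse_transversal) (use assms inv_ne_of_ord_gt_2 in auto)

lemma exists_two_independent_of_order:
  assumes fin: "finite (carrier G)" and n: "2 < n" and card: "2 < card {x \<in> carrier G. ord x = n}"
  obtains x y where "x \<in> carrier G" "y \<in> carrier G" "ord x = n" "ord y = n"
    "x \<noteq> y" "x \<noteq> inv y" "inv x \<noteq> y" "inv x \<noteq> inv y" "inv x \<noteq> x" "inv y \<noteq> y"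
proof -
  obtain Y where Y: "{x \<in> carrier G. ord x = n} = Y \<union> m_inv G ` Y" "Y \<inter> m_inv G ` Y = {}"
      "card {x \<in> carrier G. ord x = n} = 2 * card Y"
    using exists_transversal_of_order[OF fin n] by blast
  then have "1 < card Y" using card by simp
  then obtain x y where xy: "x \<in> Y" "y \<in> Y" "x \<noteq> y"
    by (metis One_nat_def card_le_Suc0_iff_eq card.infinite not_less not_less_zero)
  have c: "x \<in> carrier G" "y \<in> carrier G" "ord x = n" "ord y = n" using xy Y(1) by blast+
  have "x \<noteq> inv y" "inv x \<noteq> y" using xy Y(2) by blast+
  then show thesis
    using that[OF c xy(3)] c xy(3) inv_ne_of_ord_gt_2 n inv_inj by (metis inv_inv)
qed

lemma square_of_ord_4:
  assumes "c \<in> carrier G" "ord c = 4"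
  shows "c \<otimes> c \<in> carrier G" "ord (c \<otimes> c) = 2" "linked G (c \<otimes> c) c"
proof -
  have "c \<otimes> c = c [^] (2::nat)" using assms by (simp add: numeral_2_eq_2)
  then show "ord (c \<otimes> c) = 2" using ord_pow[of c 2] assms by simp
  have "c \<otimes> c = c [^] (2::int)"
    using assms int_pow_mult[of c 1 1] by simp
  then show "linked G (c \<otimes> c) c" using linked_int_pow[of c 2] assms linked_sym by metis
qed (use assms in auto)

text \<open>
  Two complete graphs on four vertices are glued either along the identity or, if the two
  subgroups share their involution, along an edge. They have \<open>16\<^sup>2 = 256\<close> and 192 spanning trees.
\<close>

lemma kappa_ge_two_cyclic_4:
  assumes fin: "finite (carrier G)" and card: "2 < card {x \<in> carrier G. ord x = 4}"
  shows "125 \<le> \<kappa> G"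
proof -
  obtain c d where cd: "c \<in> carrier G" "d \<in> carrier G" "ord c = 4" "ord d = 4"
    and ne: "c \<noteq> d" "c \<noteq> inv d" "inv c \<noteq> d" "inv c \<noteq> inv d" "inv c \<noteq> c" "inv d \<noteq> d"
    using exists_two_independent_of_order[OF fin _ card] by auto
  define z w where "z = c \<otimes> c" and "w = d \<otimes> d"
  note sq = square_of_ord_4[OF cd(1,3), folded z_def] square_of_ord_4[OF cd(2,4), folded w_def]
  note sq = sq sq(3,6)[THEN linked_sym]
  show ?thesis
  proof (cases "z = w")
    case True
    let ?xs = "[\<one>, z, c, inv c, d, inv d]"
    let ?nbs = "[[0], [0,2,3,4,5], [0,1,3], [0,1,2], [0,1,5], [0,1,4]]"
    have "distinct ?xs"
      using cd sq ne by (auto simp: one_eq_inv_iff)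
    moreover have "list_all2 (\<lambda>x js. \<forall>j \<in> set js. j < length ?xs \<and> linked G (?xs ! j) x) ?xs ?nbs"
      using cd sq True by (simp add: linked_inv linked_refl linked_one')
    ultimately have "length (parent_lists 5 ?nbs) \<le> \<kappa> G"
      using cd sq by (intro kappa_ge_parent_lists[OF fin, of ?xs]) auto
    moreover have "length (parent_lists 5 ?nbs) = 192" by code_simp
    ultimately show ?thesis by simp
  next
    case False
    let ?xs = "[\<one>, z, c, inv c, w, d, inv d]"
    let ?nbs = "[[0], [0,2,3], [0,1,3], [0,1,2], [0,5,6], [0,4,6], [0,4,5]]"
    have "distinct ?xs"
      using cd sq ne False by (auto simp: one_eq_inv_iff)
    moreover have "list_all2 (\<lambda>x js. \<forall>j \<in> set js. j < length ?xs \<and> linked G (?xs ! j) x) ?xs ?nbs"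
      using cd sq by (simp add: linked_inv linked_refl linked_one')
    ultimately have "length (parent_lists 3 ?nbs) \<le> \<kappa> G"
      using cd sq by (intro kappa_ge_parent_lists[OF fin, of ?xs]) auto
    moreover have "length (parent_lists 3 ?nbs) = 256" by code_simp
    ultimately show ?thesis by simp
  qed
qed

lemma kappa_ge_five_cyclic_3:
  assumes fin: "finite (carrier G)" and card: "8 < card {x \<in> carrier G. ord x = 3}"
  shows "125 \<le> \<kappa> G"
proof -
  have three: "(2::nat) < 3" by simp
  obtain Y where Y: "{x \<in> carrier G. ord x = 3} = Y \<union> m_inv G ` Y" "Y \<inter> m_inv G ` Y = {}"
      "card {x \<in> carrier G. ord x = 3} = 2 * card Y"
    using exists_transversal_of_order[OF fin three] by blast
  have "(3::nat) ^ 5 \<le> 3 ^ card Y" using Y(3) card by (intro power_increasing) auto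
  also have "\<dots> \<le> \<kappa> G" using Y(1,2) by (intro kappa_ge_triangles fin) blast+
  finally show ?thesis by simp
qed

end

section \<open>Few spanning trees\<close>

lemma connected_crossing_edge:
  assumes conn: "connected_ugraph \<Gamma>" and x: "x \<in> B" "x \<in> fst \<Gamma>" and y: "y \<notin> B" "y \<in> fst \<Gamma>"
  shows "\<exists>u v. u \<in> B \<and> v \<notin> B \<and> {u, v} \<in> snd \<Gamma>"
proof -
  have "(x, y) \<in> (adj_rel \<Gamma>)\<^sup>*" using conn x y by (auto simp: connected_ugraph_def)
  then have "x \<in> B \<longrightarrow> y \<notin> B \<longrightarrow> ?thesis"
    by (induction rule: rtrancl_induct) (auto simp: adj_rel_def)
  then show ?thesis using x y by blast
qed

text \<open>
  A spanning tree is determined by its intersections with the blocks \<open>E i\<close>, since it contains every edge of \<open>F\<close>.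
\<close>

lemma card_spanning_trees_le_blocks:
  fixes \<Gamma> :: "'v ugraph"
  assumes fin: "finite I" and edges: "snd \<Gamma> \<subseteq> F \<union> (\<Union>i\<in>I. E i)"
    and forced: "\<And>T. T \<in> spanning_trees \<Gamma> \<Longrightarrow> F \<subseteq> snd T"
    and C: "\<And>T i. T \<in> spanning_trees \<Gamma> \<Longrightarrow> i \<in> I \<Longrightarrow> snd T \<inter> E i \<in> C i" "\<And>i. i \<in> I \<Longrightarrow> finite (C i)"
  shows "card (spanning_trees \<Gamma>) \<le> (\<Prod>i\<in>I. card (C i))"
proof -
  define r where "r T = (\<lambda>i\<in>I. snd T \<inter> E i)" for T :: "'v ugraph"
  have "snd T = F \<union> (\<Union>i\<in>I. r T i)" if "T \<in> spanning_trees \<Gamma>" for T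
    using forced[OF that] that edges by (fastforce simp: r_def spanning_trees_def)
  moreover have "fst T = fst \<Gamma>" if "T \<in> spanning_trees \<Gamma>" for T
    using that by (simp add: spanning_trees_def)
  ultimately have "inj_on r (spanning_trees \<Gamma>)"
    by (metis (no_types, lifting) inj_onI prod_eqI)
  moreover have "r ` spanning_trees \<Gamma> \<subseteq> (\<Pi>\<^sub>E i\<in>I. C i)" using C by (auto simp: r_def)
  moreover have "finite (\<Pi>\<^sub>E i\<in>I. C i)" using fin C by (intro finite_PiE)
  ultimately have "card (spanning_trees \<Gamma>) \<le> card (\<Pi>\<^sub>E i\<in>I. C i)"
    by (rule card_inj_on_le)
  then show ?thesis using fin by (simp add: card_PiE)
qed

lemma pendant_edge_forced:
  assumes T: "T \<in> spanning_trees \<Gamma>" and v: "v \<in> fst \<Gamma>" "r \<in> fst \<Gamma>" "v \<noteq> r"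
    and pendant: "\<And>w. {v, w} \<in> snd \<Gamma> \<Longrightarrow> w \<noteq> v \<Longrightarrow> w = r"
  shows "{r, v} \<in> snd T"
proof -
  have "connected_ugraph T" "fst T = fst \<Gamma>" "snd T \<subseteq> snd \<Gamma>"
    using T by (auto simp: spanning_trees_def is_tree_def)
  then obtain w where "w \<noteq> v" "{v, w} \<in> snd T"
    using connected_crossing_edge[of T v "{v}" r] v by auto
  moreover from this have "w = r" using pendant \<open>snd T \<subseteq> snd \<Gamma>\<close> by blast
  ultimately show ?thesis by (simp add: insert_commute)
qed

lemma tree_has_no_triangle:
  assumes "is_tree T" "distinct [x, y, z]"
  shows "\<not> ({x, y} \<in> snd T \<and> {x, z} \<in> snd T \<and> {y, z} \<in> snd T)"
proof
  assume e: "{x, y} \<in> snd T \<and> {x, z} \<in> snd T \<and> {y, z} \<in> snd T"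
  have "{[x, y, z] ! i, [x, y, z] ! (Suc i mod 3)} \<in> snd T" if "i < 3" for i
  proof -
    have "i = 0 \<or> i = 1 \<or> i = 2" using that by auto
    then show ?thesis using e by (elim disjE) (simp_all add: insert_commute)
  qed
  then have "is_cycle T [x, y, z]"
    using assms(2) by (simp add: is_cycle_def)
  then show False using assms(1) by (auto simp: is_tree_def)
qed

text \<open>
  If a triangle meets the rest of the graph in the vertex \<open>r\<close> only, then a spanning tree contains exactly two
  of its sides: not all three, and at least one of the two sides that leave each of \<open>{x}\<close>, \<open>{y}\<close> and
  \<open>{x, y}\<close>.
\<close>

lemma spanning_tree_meets_block_triangle:
  assumes T: "T \<in> spanning_trees \<Gamma>" and v: "x \<in> fst \<Gamma>" "y \<in> fst \<Gamma>" "r \<in> fst \<Gamma>" "distinct [r, x, y]"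
    and block: "\<And>w. {x, w} \<in> snd \<Gamma> \<Longrightarrow> w \<in> {r, x, y}" "\<And>w. {y, w} \<in> snd \<Gamma> \<Longrightarrow> w \<in> {r, x, y}"
  shows "snd T \<inter> {{r, x}, {r, y}, {x, y}} \<in> {{{r, x}, {r, y}}, {{r, x}, {x, y}}, {{r, y}, {x, y}}}"
proof -
  have T': "connected_ugraph T" "fst T = fst \<Gamma>" "snd T \<subseteq> snd \<Gamma>" "is_tree T"
    using T by (auto simp: spanning_trees_def is_tree_def)
  have nbr: "w \<in> {r, x, y}" if "{x, w} \<in> snd T \<or> {y, w} \<in> snd T" for w
    using that block T'(3) by blast
  obtain p where "p \<noteq> x" "{x, p} \<in> snd T"
    using connected_crossing_edge[OF T'(1), of x "{x}" r] v T'(2) by auto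
  with nbr[of p] have "{x, r} \<in> snd T \<or> {x, y} \<in> snd T" by blast
  moreover obtain q where "q \<noteq> y" "{y, q} \<in> snd T"
    using connected_crossing_edge[OF T'(1), of y "{y}" r] v T'(2) by auto
  with nbr[of q] have "{y, r} \<in> snd T \<or> {y, x} \<in> snd T" by blast
  moreover obtain s t where "s \<in> {x, y}" "t \<notin> {x, y}" "{s, t} \<in> snd T"
    using connected_crossing_edge[OF T'(1), of x "{x, y}" r] v T'(2) by auto
  with nbr[of t] have "{x, r} \<in> snd T \<or> {y, r} \<in> snd T" by blast
  ultimately have "{r, x} \<in> snd T \<or> {x, y} \<in> snd T" "{r, y} \<in> snd T \<or> {x, y} \<in> snd T"
      "{r, x} \<in> snd T \<or> {r, y} \<in> snd T"
    unfolding insert_commute[of x r] insert_commute[of y r] insert_commute[of y x] by blast+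
  then show ?thesis
    using tree_has_no_triangle[OF T'(4) v(4)] by auto
qed

context group
begin

lemma spanning_tree_pendant:
  assumes "T \<in> spanning_trees (power_graph G)" "v \<in> carrier G" "v \<noteq> \<one>"
    and "\<And>w. w \<in> carrier G \<Longrightarrow> w \<noteq> v \<Longrightarrow> linked G v w \<Longrightarrow> w = \<one>"
  shows "{\<one>, v} \<in> snd T"
proof (rule pendant_edge_forced[OF assms(1)])
  fix w assume "{v, w} \<in> snd (power_graph G)" "w \<noteq> v"
  then show "w = \<one>" using assms(4) by (auto simp: power_graph_edge_iff)
qed (use assms in \<open>auto simp: power_graph_def\<close>)

lemma linked_pow_cases:
  assumes "x \<in> carrier G" "y \<in> carrier G" "linked G x y" "ord x \<noteq> 0" "ord y \<noteq> 0"
  shows "(\<exists>k < ord y. x = y [^] k) \<or> (\<exists>k < ord x. y = x [^] k)"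
proof -
  have "\<exists>k < ord y. x = y [^] k"
    if "generate G {x} \<subseteq> generate G {y}" and y: "y \<in> carrier G" "ord y \<noteq> 0" for x y
  proof -
    have "x \<in> generate G {y}" using that by (meson generate.incl singletonI subsetD)
    then obtain k :: nat where "x = y [^] k"
      unfolding generate_pow_nat[OF y] by blast
    also have "y [^] k = y [^] (k mod ord y)"
      using that by (metis mod_mult_div_eq nat_pow_mult nat_pow_one nat_pow_pow pow_ord_eq_1 r_one nat_pow_closed)
    finally show ?thesis using that by (intro exI[of _ "k mod ord y"]) auto
  qed
  then show ?thesis using assms by (auto simp: linked_def)
qed

text \<open>
  The power graph consists of pendant edges at the identity and of at most four triangles, formed by the
  identity and two inverse elements of order 3. Each triangle contributes a factor 3.
\<close>

lemma kappa_le_of_orders_123: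
  assumes fin: "finite (carrier G)" and ords: "\<And>x. x \<in> carrier G \<Longrightarrow> ord x \<in> {1, 2, 3}"
    and card: "card {x \<in> carrier G. ord x = 3} \<le> 8"
  shows "\<kappa> G \<le> 81"
proof -
  let ?S = "{x \<in> carrier G. ord x = 3}"
  have three: "(2::nat) < 3" by simp
  obtain Y where Y: "?S = Y \<union> m_inv G ` Y" "Y \<inter> m_inv G ` Y = {}" "card ?S = 2 * card Y"
    using exists_transversal_of_order[OF fin three] by blast
  have finY: "finite Y" using Y(1) fin by (metis (no_types, lifting) finite_Un finite_subset mem_Collect_eq subsetI)
  \<comment> \<open>Away from the identity, only inverse elements of order 3 are joined.\<close>
  have adj: "w = \<one> \<or> w = v \<or> w = inv v \<and> ord v = 3"
    if "v \<in> carrier G" "v \<noteq> \<one>" "w \<in> carrier G" "linked G v w" for v w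
  proof -
    have pow: "x = \<one> \<or> x = y \<or> x = inv y \<and> ord y = 3"
      if y: "y \<in> carrier G" and k: "k < ord y" "x = y [^] k" for x y and k :: nat
    proof -
      have "k = 0 \<or> k = 1 \<or> k = 2 \<and> ord y = 3" using k(1) ords[OF y] by auto
      moreover have "y [^] (2::nat) = inv y" if "ord y = 3"
        using pow_ord_eq_1[OF y] y that by (metis inv_equality nat_pow_Suc nat_pow_closed numeral_2_eq_2 numeral_3_eq_3
            nat_pow_Suc2)
      ultimately show ?thesis using y k(2) by auto
    qed
    have "ord v \<noteq> 0" "ord w \<noteq> 0" using ords that by fastforce+
    then have "v = \<one> \<or> v = w \<or> v = inv w \<and> ord w = 3 \<or> w = \<one> \<or> w = v \<or> w = inv v \<and> ord v = 3"
      using linked_pow_cases[of v w] pow[of v _ w] pow[of w _ v] that by blast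
    then show ?thesis using that by auto
  qed
  define F where "F = (\<lambda>v. {\<one>, v}) ` {v \<in> carrier G. v \<noteq> \<one> \<and> ord v \<noteq> 3}"
  define E where "E y = {{\<one>, y}, {\<one>, inv y}, {y, inv y}}" for y
  define C where "C y = {{{\<one>, y}, {\<one>, inv y}}, {{\<one>, y}, {y, inv y}}, {{\<one>, inv y}, {y, inv y}}}" for y
  have one: "ord v = 3 \<Longrightarrow> v \<noteq> \<one>" for v by auto
  have "\<kappa> G \<le> (\<Prod>y\<in>Y. card (C y))"
    unfolding \<kappa>_def
  proof (rule card_spanning_trees_le_blocks[OF finY])
    show "snd (power_graph G) \<subseteq> F \<union> (\<Union>y\<in>Y. E y)"
    proof
      fix e assume "e \<in> snd (power_graph G)"
      then obtain x y where e: "e = {x, y}" and xy: "x \<in> carrier G" "y \<in> carrier G" "x \<noteq> y" "linked G x y"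
        by (auto simp: power_graph_def linked_def)
      have "\<exists>v \<in> carrier G. v \<noteq> \<one> \<and> (e = {\<one>, v} \<or> e = {v, inv v} \<and> ord v = 3)"
      proof (cases "x = \<one>")
        case True
        then show ?thesis using e xy by (intro bexI[of _ y]) auto
      next
        case False
        then show ?thesis
          using e xy adj[of x y] by (intro bexI[of _ x]) (auto simp: insert_commute)
      qed
      then obtain v where v: "v \<in> carrier G" "v \<noteq> \<one>" "e = {\<one>, v} \<or> e = {v, inv v} \<and> ord v = 3" by blast
      show "e \<in> F \<union> (\<Union>y\<in>Y. E y)"
      proof (cases "ord v = 3")
        case True
        then have "v \<in> Y \<union> m_inv G ` Y" using Y(1) v(1) by blast
        then obtain y where "y \<in> Y" "v = y \<or> v = inv y" by blast
        moreover have "y \<in> carrier G" using Y(1) \<open>y \<in> Y\<close> by blast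
        ultimately show ?thesis using v(3) by (auto simp: E_def insert_commute)
      qed (use v in \<open>auto simp: F_def\<close>)
    qed
    show "F \<subseteq> snd T" if "T \<in> spanning_trees (power_graph G)" for T
      using spanning_tree_pendant[OF that] adj by (fastforce simp: F_def)
    show "finite (C y)" for y by (simp add: C_def)
    show "snd T \<inter> E y \<in> C y" if T: "T \<in> spanning_trees (power_graph G)" and "y \<in> Y" for T y
    proof -
      have y: "y \<in> carrier G" "ord y = 3" using Y(1) \<open>y \<in> Y\<close> by blast+
      show ?thesis
        unfolding E_def C_def
      proof (rule spanning_tree_meets_block_triangle[OF T])
        show "distinct [\<one>, y, inv y]"
          using y inv_ne_of_ord_gt_2[of y] one[of y] by (auto simp: one_eq_inv_iff)
        show "w \<in> {\<one>, y, inv y}" if "{y, w} \<in> snd (power_graph G)" for w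
          using that adj[of y w] y one[of y] by (auto simp: power_graph_edge_iff)
        show "w \<in> {\<one>, y, inv y}" if "{inv y, w} \<in> snd (power_graph G)" for w
          using that adj[of "inv y" w] y one[of "inv y"] by (auto simp: power_graph_edge_iff)
      qed (use y in \<open>auto simp: power_graph_def\<close>)
    qed
  qed
  also have "\<dots> \<le> (\<Prod>y\<in>Y. 3)"
    by (intro prod_mono) (auto simp: C_def card_insert_if)
  also have "\<dots> = 3 ^ card Y" by simp
  also have "\<dots> \<le> 3 ^ 4" using Y(3) card by (intro power_increasing) auto
  finally show ?thesis by simp
qed

text \<open>
  Apart from pendant edges at the identity, which belong to every spanning tree, there are only the six
  edges between elements of the cyclic group generated by \<open>c\<close>; they have \<open>2\<^sup>6\<close> subsets.
\<close>

lemma kappa_le_of_orders_124: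
  assumes fin: "finite (carrier G)" and ords: "\<And>x. x \<in> carrier G \<Longrightarrow> ord x \<in> {1, 2, 4}"
    and c: "c \<in> carrier G" "ord c = 4" and card: "card {x \<in> carrier G. ord x = 4} \<le> 2"
  shows "\<kappa> G \<le> 64"
proof -
  let ?S = "{x \<in> carrier G. ord x = 4}"
  have S: "v \<in> {c, inv c}" if "v \<in> carrier G" "ord v = 4" for v
  proof -
    have "{c, inv c} \<subseteq> ?S" "card {c, inv c} = 2"
      using c inv_ne_of_ord_gt_2[of c] by auto
    then have "{c, inv c} = ?S" using card fin by (intro card_seteq) auto
    then show ?thesis using that by blast
  qed
  define B where "B = {\<one>, c, c \<otimes> c, inv c}"
  have B: "\<one> \<in> B" "c \<in> B" "inv c \<in> B" by (auto simp: B_def)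
  have "v [^] (k::nat) \<in> B" if v: "v \<in> carrier G" "ord v = 4" and "k < 4" for v k
  proof -
    have c4: "c \<otimes> c \<otimes> c \<otimes> c = \<one>"
      using pow_ord_eq_1[OF c(1)] c by (simp add: numeral_eq_Suc)
    then have c3: "c \<otimes> c \<otimes> c = inv c" using c by (metis inv_equality m_closed)
    then have c2: "inv c \<otimes> inv c = c \<otimes> c" using c by (metis inv_closed inv_solve_right m_assoc m_closed)
    then have "inv c \<otimes> inv c \<otimes> inv c = c" using c by (simp add: m_assoc)
    moreover have "k = 0 \<or> k = 1 \<or> k = 2 \<or> k = 3" using \<open>k < 4\<close> by auto
    ultimately show ?thesis
      using S[OF v] c c2 c3 by (auto simp: B_def numeral_2_eq_2 numeral_3_eq_3)
  qed note pow = this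
  have adj: "w = \<one> \<or> w = v \<or> v \<in> B \<and> w \<in> B"
    if "v \<in> carrier G" "v \<noteq> \<one>" "w \<in> carrier G" "linked G v w" for v w
  proof -
    have *: "x = \<one> \<or> x = y \<or> y \<in> B \<and> x \<in> B"
      if y: "y \<in> carrier G" and k: "k < ord y" "x = y [^] k" for x y and k :: nat
    proof (cases "ord y = 4")
      case True
      then show ?thesis using pow[OF y True] k S[OF y True] B by auto
    next
      case False
      then have "k = 0 \<or> k = 1" using k(1) ords[OF y] by auto
      then show ?thesis using y k(2) by auto
    qed
    have "ord v \<noteq> 0" "ord w \<noteq> 0" using ords that by fastforce+
    then have "v = \<one> \<or> v = w \<or> w \<in> B \<and> v \<in> B \<or> w = \<one> \<or> w = v \<or> v \<in> B \<and> w \<in> B"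
      using linked_pow_cases[of v w] *[of v _ w] *[of w _ v] that by blast
    then show ?thesis using that by auto
  qed
  define F where "F = (\<lambda>v. {\<one>, v}) ` (carrier G - B)"
  define E where "E = {e \<in> Pow B. card e = 2}"
  have "finite B" by (simp add: B_def)
  have "\<kappa> G \<le> (\<Prod>i\<in>{()}. card (Pow E))"
    unfolding \<kappa>_def
  proof (rule card_spanning_trees_le_blocks)
    show "snd (power_graph G) \<subseteq> F \<union> (\<Union>i\<in>{()}. E)"
    proof
      fix e assume "e \<in> snd (power_graph G)"
      then obtain x y where e: "e = {x, y}" and xy: "x \<in> carrier G" "y \<in> carrier G" "x \<noteq> y" "linked G x y"
        by (auto simp: power_graph_def linked_def)
      have "x \<in> B \<and> y \<in> B \<or> x = \<one> \<or> y = \<one>"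
        using adj[of x y] xy B(1) by auto
      then show "e \<in> F \<union> (\<Union>i\<in>{()}. E)"
        using e xy B(1) by (auto simp: F_def E_def insert_commute)
    qed
    show "F \<subseteq> snd T" if "T \<in> spanning_trees (power_graph G)" for T
      using spanning_tree_pendant[OF that] adj B(1) by (fastforce simp: F_def)
    show "finite (Pow E)" using \<open>finite B\<close> by (simp add: E_def)
  qed auto
  also have "\<dots> = 2 ^ (card B choose 2)"
    using \<open>finite B\<close> by (simp add: card_Pow E_def n_subsets)
  also have "\<dots> \<le> 2 ^ (4 choose 2)"
  proof -
    have "card B \<le> 4" by (simp add: B_def card_insert_if)
    then show ?thesis by (intro power_increasing binomial_right_mono) auto
  qed
  also have "\<dots> = (64::nat)" by (simp add: choose_two)
  finally show ?thesis .
qed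

end

section \<open>Semidirect products\<close>

lemma carrier_semidirect_product [simp]:
  "carrier (semidirect_product N H \<phi>) = carrier N \<times> carrier H"
  by (simp add: semidirect_product_def)

lemma one_semidirect_product [simp]: "\<one>\<^bsub>semidirect_product N H \<phi>\<^esub> = (\<one>\<^bsub>N\<^esub>, \<one>\<^bsub>H\<^esub>)"
  by (simp add: semidirect_product_def)

lemma mult_semidirect_product [simp]:
  "(n, h) \<otimes>\<^bsub>semidirect_product N H \<phi>\<^esub> (n', h') = (n \<otimes>\<^bsub>N\<^esub> \<phi> h n', h \<otimes>\<^bsub>H\<^esub> h')"
  by (simp add: semidirect_product_def)

lemma hom_AutoGroupD:
  assumes \<phi>: "\<phi> \<in> hom H (AutoGroup N)" and H: "group H" and h: "h \<in> carrier H"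
  shows "n \<in> carrier N \<Longrightarrow> \<phi> h n \<in> carrier N"
    and "n \<in> carrier N \<Longrightarrow> m \<in> carrier N \<Longrightarrow> \<phi> h (n \<otimes>\<^bsub>N\<^esub> m) = \<phi> h n \<otimes>\<^bsub>N\<^esub> \<phi> h m"
    and "k \<in> carrier H \<Longrightarrow> n \<in> carrier N \<Longrightarrow> \<phi> (h \<otimes>\<^bsub>H\<^esub> k) n = \<phi> h (\<phi> k n)"
proof -
  have auto: "\<phi> k \<in> auto N" if "k \<in> carrier H" for k
    using hom_in_carrier[OF \<phi> that] by (simp add: AutoGroup_def)
  then show "n \<in> carrier N \<Longrightarrow> \<phi> h n \<in> carrier N"
    and "n \<in> carrier N \<Longrightarrow> m \<in> carrier N \<Longrightarrow> \<phi> h (n \<otimes>\<^bsub>N\<^esub> m) = \<phi> h n \<otimes>\<^bsub>N\<^esub> \<phi> h m"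
    using h by (auto simp: auto_def hom_def)
  show "k \<in> carrier H \<Longrightarrow> n \<in> carrier N \<Longrightarrow> \<phi> (h \<otimes>\<^bsub>H\<^esub> k) n = \<phi> h (\<phi> k n)"
    using hom_mult[OF \<phi> h, of k] auto[OF h] auto[of k]
    by (auto simp: AutoGroup_def BijGroup_def auto_def compose_def)
qed

lemma hom_AutoGroup_one:
  assumes \<phi>: "\<phi> \<in> hom H (AutoGroup N)" and H: "group H" and N: "group N" and n: "n \<in> carrier N"
  shows "\<phi> \<one>\<^bsub>H\<^esub> n = n"
proof -
  have "\<phi> \<one>\<^bsub>H\<^esub> = \<one>\<^bsub>AutoGroup N\<^esub>"
    by (rule hom_one[OF \<phi> H group.AutoGroup[OF N]])
  then show ?thesis using n by (simp add: AutoGroup_def BijGroup_def)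
qed

lemma group_semidirect_product:
  assumes N: "group N" and H: "group H" and \<phi>: "\<phi> \<in> hom H (AutoGroup N)"
  shows "group (semidirect_product N H \<phi>)"
proof -
  interpret N: group N by (fact N)
  interpret H: group H by (fact H)
  note act = hom_AutoGroupD[OF \<phi> H] hom_AutoGroup_one[OF \<phi> H N]
  show ?thesis
  proof (rule groupI)
    fix x y z
    assume "x \<in> carrier (semidirect_product N H \<phi>)" "y \<in> carrier (semidirect_product N H \<phi>)"
      "z \<in> carrier (semidirect_product N H \<phi>)"
    then show "x \<otimes>\<^bsub>semidirect_product N H \<phi>\<^esub> y \<otimes>\<^bsub>semidirect_product N H \<phi>\<^esub> z =
        x \<otimes>\<^bsub>semidirect_product N H \<phi>\<^esub> (y \<otimes>\<^bsub>semidirect_product N H \<phi>\<^esub> z)"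
      by (auto simp: act N.m_assoc H.m_assoc)
  next
    fix x assume "x \<in> carrier (semidirect_product N H \<phi>)"
    then obtain n h where x: "x = (n, h)" "n \<in> carrier N" "h \<in> carrier H" by auto
    have "\<phi> (inv\<^bsub>H\<^esub> h) (inv\<^bsub>N\<^esub> n) \<otimes>\<^bsub>N\<^esub> \<phi> (inv\<^bsub>H\<^esub> h) n = \<phi> (inv\<^bsub>H\<^esub> h) (\<one>\<^bsub>N\<^esub> \<otimes>\<^bsub>N\<^esub> \<one>\<^bsub>N\<^esub>)"
      using x by (simp flip: act(2))
    also have "\<dots> = \<one>\<^bsub>N\<^esub>"
    proof -
      have "\<phi> (inv\<^bsub>H\<^esub> h) \<in> hom N N" using x act(1,2) by (intro homI) auto
      then show ?thesis using hom_one[OF _ N N] by simp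
    qed
    finally show "\<exists>y\<in>carrier (semidirect_product N H \<phi>).
        y \<otimes>\<^bsub>semidirect_product N H \<phi>\<^esub> x = \<one>\<^bsub>semidirect_product N H \<phi>\<^esub>"
      using x act(1) by (intro bexI[of _ "(\<phi> (inv\<^bsub>H\<^esub> h) (inv\<^bsub>N\<^esub> n), inv\<^bsub>H\<^esub> h)"]) auto
  qed (auto simp: act)
qed

text \<open>
  The recognition criterion for internal semidirect products; \<open>conj\<close> says that conjugation by \<open>g h\<close>
  acts on the image of \<open>N\<close> as \<open>\<phi> h\<close>.
\<close>

lemma (in group) semidirect_product_embedding:
  assumes N: "group N" and H: "group H" and \<phi>: "\<phi> \<in> hom H (AutoGroup N)"
    and f: "f \<in> hom N G" "inj_on f (carrier N)" and g: "g \<in> hom H G" "inj_on g (carrier H)"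
    and conj: "\<And>n h. n \<in> carrier N \<Longrightarrow> h \<in> carrier H \<Longrightarrow> g h \<otimes> f n = f (\<phi> h n) \<otimes> g h"
    and triv: "\<And>n h. n \<in> carrier N \<Longrightarrow> h \<in> carrier H \<Longrightarrow> f n = g h \<Longrightarrow> f n = \<one>"
  shows "(\<lambda>(n, h). f n \<otimes> g h) \<in> hom (semidirect_product N H \<phi>) G"
    and "inj_on (\<lambda>(n, h). f n \<otimes> g h) (carrier (semidirect_product N H \<phi>))"
proof -
  interpret N: group N by (fact N)
  interpret H: group H by (fact H)
  interpret f: group_hom N G f using f by unfold_locales
  interpret g: group_hom H G g using g by unfold_locales
  interpret S: group "semidirect_product N H \<phi>" by (rule group_semidirect_product[OF N H \<phi>])
  let ?F = "\<lambda>(n, h). f n \<otimes> g h"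
  note act = hom_AutoGroupD[OF \<phi> H]
  show hom: "?F \<in> hom (semidirect_product N H \<phi>) G"
  proof (rule homI)
    fix x y assume "x \<in> carrier (semidirect_product N H \<phi>)" "y \<in> carrier (semidirect_product N H \<phi>)"
    then obtain n h n' h' where xy: "x = (n, h)" "y = (n', h')"
      and c: "n \<in> carrier N" "h \<in> carrier H" "n' \<in> carrier N" "h' \<in> carrier H" by auto
    have "f n \<otimes> (g h \<otimes> f n') \<otimes> g h' = f n \<otimes> (f (\<phi> h n') \<otimes> g h) \<otimes> g h'"
      using c by (simp add: conj)
    then show "?F (x \<otimes>\<^bsub>semidirect_product N H \<phi>\<^esub> y) = ?F x \<otimes> ?F y"
      using c act by (simp add: xy m_assoc)
  qed auto
  interpret F: group_hom "semidirect_product N H \<phi>" G ?F using hom by unfold_locales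
  show "inj_on ?F (carrier (semidirect_product N H \<phi>))"
    unfolding F.inj_on_one_iff
  proof (intro allI impI)
    fix x assume "x \<in> carrier (semidirect_product N H \<phi>)" and eq: "?F x = \<one>"
    then obtain n h where x: "x = (n, h)" "n \<in> carrier N" "h \<in> carrier H" by auto
    have "f n = g (inv\<^bsub>H\<^esub> h)" using eq x by (simp add: inv_equality[symmetric])
    then have "f n = \<one>" "g h = \<one>" using triv[of n "inv\<^bsub>H\<^esub> h"] eq x by auto
    then show "x = \<one>\<^bsub>semidirect_product N H \<phi>\<^esub>"
      using x f(2) g(2) by (simp add: f.inj_on_one_iff g.inj_on_one_iff)
  qed
qed

lemma (in group) is_iso_of_embedding:
  assumes S: "group S" and F: "F \<in> hom S G" "inj_on F (carrier S)" "carrier G \<subseteq> F ` carrier S"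
  shows "G \<cong> S"
proof -
  have "F \<in> iso S G" using F by (auto simp: iso_iff hom_def)
  then show ?thesis using group.iso_sym[OF S] is_isoI by blast
qed

section \<open>Inversion actions\<close>

text \<open>
  With this action of the group of order 2, the semidirect product is the generalised dihedral group of \<open>N\<close>.
  The domain is restricted to the carrier because automorphisms are represented by extensional functions.
\<close>

definition inversion_action :: "('a, 'b) monoid_scheme \<Rightarrow> int \<Rightarrow> 'a \<Rightarrow> 'a" where
  "inversion_action N = (\<lambda>s. \<lambda>r \<in> carrier N. if s = 0 then r else inv\<^bsub>N\<^esub> r)"

lemma dihedral_group_eq:
  "dihedral_group n = semidirect_product (integer_mod_group n) (integer_mod_group 2)
     (inversion_action (integer_mod_group n))"
  by (simp add: dihedral_group_def inversion_action_def)

lemma carrier_Z2: "carrier (integer_mod_group 2) = {0, 1}"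
  by (auto simp: carrier_integer_mod_group)

lemma carrier_Z3: "carrier (integer_mod_group 3) = {0, 1, 2}"
  by (auto simp: carrier_integer_mod_group)

lemma (in comm_group) inversion_action_hom:
  "inversion_action G \<in> hom (integer_mod_group 2) (AutoGroup G)"
proof -
  have "(\<lambda>x \<in> carrier G. inv x) \<in> auto G"
    unfolding auto_def Bij_def
  proof (intro IntI CollectI)
    show "(\<lambda>x \<in> carrier G. inv x) \<in> hom G G" by (auto simp: hom_def inv_mult)
    show "bij_betw (\<lambda>x \<in> carrier G. inv x) (carrier G) (carrier G)"
      by (rule bij_betwI[of _ _ _ "m_inv G"]) auto
  qed auto
  then have "inversion_action G s \<in> auto G" for s
    using id_in_auto by (cases "s = 0") (simp_all add: inversion_action_def)
  then show ?thesis
    by (intro homI) (auto simp: AutoGroup_def BijGroup_def auto_def carrier_Z2 inversion_action_def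
        compose_def fun_eq_iff restrict_def)
qed

lemma (in group) inversion_semidirect_embedding:
  assumes N: "comm_group N" and f: "f \<in> hom N G" "inj_on f (carrier N)"
    and t: "t \<in> carrier G" "t \<notin> f ` carrier N" "t \<otimes> t = \<one>"
    and inverts: "\<forall>n \<in> carrier N. t \<otimes> f n = inv (f n) \<otimes> t"
  shows "\<exists>F. F \<in> hom (semidirect_product N (integer_mod_group 2) (inversion_action N)) G \<and>
    inj_on F (carrier N \<times> {0, 1}) \<and> F ` (carrier N \<times> {0, 1}) = f ` carrier N \<union> (\<lambda>x. x \<otimes> t) ` f ` carrier N"
proof -
  interpret N: comm_group N by (fact N)
  interpret f: group_hom N G f using f by unfold_locales
  define g where "g s = (if s = 0 then \<one> else t)" for s :: int
  have "t \<noteq> \<one>" using t(2) f.hom_one N.one_closed by (metis imageI)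
  then have inj_g: "inj_on g (carrier (integer_mod_group 2))" by (auto simp: g_def carrier_Z2)
  have g: "g \<in> hom (integer_mod_group 2) G"
    using t by (intro homI) (auto simp: g_def carrier_Z2)
  have "g h \<otimes> f n = f (inversion_action N h n) \<otimes> g h" and "f n = g h \<Longrightarrow> f n = \<one>"
    if "n \<in> carrier N" "h \<in> carrier (integer_mod_group 2)" for n h
    using that inverts t by (auto simp: carrier_Z2 g_def inversion_action_def)
  note * = semidirect_product_embedding[OF N.is_group group_integer_mod_group
      N.inversion_action_hom f g inj_g this]
  have "(\<lambda>(n, h). f n \<otimes> g h) ` (carrier N \<times> {0, 1}) = f ` carrier N \<union> (\<lambda>x. x \<otimes> t) ` f ` carrier N"
    by (force simp: g_def image_iff)
  then show ?thesis using * by (intro exI[of _ "\<lambda>(n, h). f n \<otimes> g h"]) (simp add: carrier_Z2)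
qed

section \<open>Subgroups whose complement consists of involutions\<close>

context group
begin

text \<open>
  If \<open>t\<close> lies outside \<open>C\<close>, then so does \<open>t \<otimes> x\<close>, and both are their own inverses.
\<close>

lemma involution_complement_inverts:
  assumes C: "subgroup C G" and sq: "\<forall>x \<in> carrier G - C. x \<otimes> x = \<one>"
    and t: "t \<in> carrier G" "t \<notin> C" and x: "x \<in> C"
  shows "t \<otimes> x = inv x \<otimes> t"
proof -
  have xc: "x \<in> carrier G" using C x by (rule subgroup.mem_carrier)
  have "t \<otimes> x \<notin> C"
  proof
    assume "t \<otimes> x \<in> C"
    then have "t \<otimes> x \<otimes> inv x \<in> C" using C x by (simp add: subgroup.m_closed subgroup.m_inv_closed)
    then show False using t xc by (simp add: m_assoc)
  qed
  then have "inv (t \<otimes> x) = t \<otimes> x" using sq t xc by (simp add: inv_equality)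
  moreover have "inv t = t" using sq t by (simp add: inv_equality)
  ultimately show ?thesis using t xc by (simp add: inv_mult_group)
qed

text \<open>
  Inversion on \<open>C\<close> is conjugation by \<open>t\<close>, hence multiplicative; this forces \<open>C\<close> to be abelian.
\<close>

lemma involution_complement_commute:
  assumes C: "subgroup C G" and sq: "\<forall>x \<in> carrier G - C. x \<otimes> x = \<one>"
    and t: "t \<in> carrier G" "t \<notin> C" and xy: "x \<in> C" "y \<in> C"
  shows "x \<otimes> y = y \<otimes> x"
proof -
  note inverts = involution_complement_inverts[OF C sq t]
  have c: "x \<in> carrier G" "y \<in> carrier G" using xy subgroup.mem_carrier[OF C] by auto
  have "inv (x \<otimes> y) \<otimes> t = t \<otimes> (x \<otimes> y)" using inverts[of "x \<otimes> y"] subgroup.m_closed[OF C xy] by simp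
  also have "\<dots> = inv x \<otimes> (t \<otimes> y)" using inverts[OF xy(1)] t c by (simp flip: m_assoc)
  also have "\<dots> = inv x \<otimes> inv y \<otimes> t" using inverts[OF xy(2)] t c by (simp add: m_assoc)
  finally have "inv (x \<otimes> y) = inv (y \<otimes> x)" using t c by (simp add: inv_mult_group)
  then show ?thesis using c by (metis inv_inv m_closed)
qed

text \<open>
  If \<open>s\<close> and \<open>t\<close> both invert \<open>c\<close>, then their product centralises \<open>c\<close>; outside \<open>C\<close> it would also invert \<open>c\<close>.
\<close>

lemma involution_complement_index_2:
  assumes C: "subgroup C G" and sq: "\<forall>x \<in> carrier G - C. x \<otimes> x = \<one>"
    and t: "t \<in> carrier G" "t \<notin> C" and s: "s \<in> carrier G" "s \<notin> C" and c: "c \<in> C" "c \<otimes> c \<noteq> \<one>"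
  shows "s \<otimes> t \<in> C"
proof (rule ccontr)
  assume st: "s \<otimes> t \<notin> C"
  note inverts = involution_complement_inverts[OF C sq]
  have cc: "c \<in> carrier G" using C c(1) by (rule subgroup.mem_carrier)
  have "inv c \<otimes> (s \<otimes> t) = s \<otimes> t \<otimes> c" using inverts[OF _ st c(1)] s t by simp
  also have "\<dots> = s \<otimes> (inv c \<otimes> t)" using inverts[OF t c(1)] s t cc by (simp add: m_assoc)
  also have "\<dots> = c \<otimes> (s \<otimes> t)"
    using inverts[OF s subgroup.m_inv_closed[OF C c(1)]] s t cc by (simp flip: m_assoc)
  finally have "inv c = c" using s t cc by simp
  then show False using c cc by (metis r_inv)
qed

lemma iso_of_involution_complement:
  assumes N: "comm_group N" and f: "f \<in> hom N G" "inj_on f (carrier N)"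
    and sq: "\<forall>x \<in> carrier G - f ` carrier N. x \<otimes> x = \<one>"
    and t: "t \<in> carrier G" "t \<notin> f ` carrier N" and c: "c \<in> f ` carrier N" "c \<otimes> c \<noteq> \<one>"
  shows "G \<cong> semidirect_product N (integer_mod_group 2) (inversion_action N)"
proof -
  interpret N: comm_group N by (fact N)
  interpret f: group_hom N G f using f by unfold_locales
  note C = f.img_is_subgroup
  have inverts: "\<forall>n \<in> carrier N. t \<otimes> f n = inv (f n) \<otimes> t"
    using involution_complement_inverts[OF C sq t] by blast
  have tt: "t \<otimes> t = \<one>" using sq t by blast
  obtain F where F: "F \<in> hom (semidirect_product N (integer_mod_group 2) (inversion_action N)) G"
    "inj_on F (carrier N \<times> {0, 1})"
    "F ` (carrier N \<times> {0, 1}) = f ` carrier N \<union> (\<lambda>x. x \<otimes> t) ` f ` carrier N"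
    using inversion_semidirect_embedding[OF N f t tt inverts] by (elim exE conjE)
  have "x \<in> F ` (carrier N \<times> {0, 1})" if x: "x \<in> carrier G" for x
  proof (cases "x \<in> f ` carrier N")
    case False
    have "x \<otimes> t \<in> f ` carrier N"
      by (rule involution_complement_index_2[OF C sq t x False c])
    moreover have "x = x \<otimes> t \<otimes> t" using x t tt by (simp add: m_assoc)
    ultimately show ?thesis unfolding F(3) by blast
  qed (simp add: F(3))
  then show ?thesis
    using F by (intro is_iso_of_embedding[of _ F] group_semidirect_product N.inversion_action_hom)
      (auto simp: carrier_Z2)
qed

end

section \<open>Embedding the small abelian groups\<close>

context group
begin

lemma int_pow_hom_integer_mod_group:
  assumes a: "a \<in> carrier G" "a [^] n = \<one>"
  shows "(\<lambda>i::int. a [^] i) \<in> hom (integer_mod_group n) G"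
proof (rule homI)
  fix x y :: int
  have "int (ord a) dvd int n" using a pow_eq_id[of a n] by simp
  then have "int (ord a) dvd (x + y) - (x + y) mod int n"
    by (metis dvd_minus_mod dvd_trans)
  then have "a [^] ((x + y) mod int n) = a [^] (x + y)" using a int_pow_eq by blast
  then show "a [^] (x \<otimes>\<^bsub>integer_mod_group n\<^esub> y) = a [^] x \<otimes> a [^] y"
    using a by (simp add: int_pow_mult)
qed (use a in simp)

lemma int_pow_inj_integer_mod_group:
  assumes a: "a \<in> carrier G" "0 < ord a"
  shows "inj_on (\<lambda>i::int. a [^] i) (carrier (integer_mod_group (ord a)))"
proof
  fix i j assume ij: "i \<in> carrier (integer_mod_group (ord a))" "j \<in> carrier (integer_mod_group (ord a))"
    "a [^] i = a [^] j"
  then have "int (ord a) dvd j - i" using int_pow_eq a by simp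
  then show "i = j"
    using ij a dvd_imp_le_int[of "j - i" "int (ord a)"]
    by (cases "i = j") (auto simp: carrier_integer_mod_group)
qed

lemma DirProd_embedding:
  assumes N: "group N" and M: "group M"
    and f: "f \<in> hom N G" "inj_on f (carrier N)" and g: "g \<in> hom M G" "inj_on g (carrier M)"
    and comm: "\<And>n m. n \<in> carrier N \<Longrightarrow> m \<in> carrier M \<Longrightarrow> g m \<otimes> f n = f n \<otimes> g m"
    and triv: "\<And>n m. n \<in> carrier N \<Longrightarrow> m \<in> carrier M \<Longrightarrow> f n = g m \<Longrightarrow> f n = \<one>"
  shows "(\<lambda>(n, m). f n \<otimes> g m) \<in> hom (N \<times>\<times> M) G"
    and "inj_on (\<lambda>(n, m). f n \<otimes> g m) (carrier (N \<times>\<times> M))"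
proof -
  interpret N: group N by (fact N)
  interpret M: group M by (fact M)
  interpret f: group_hom N G f using f by unfold_locales
  interpret g: group_hom M G g using g by unfold_locales
  interpret P: group "N \<times>\<times> M" by (rule DirProd_group[OF N M])
  let ?F = "\<lambda>(n, m). f n \<otimes> g m"
  show hom: "?F \<in> hom (N \<times>\<times> M) G"
  proof (rule homI)
    fix x y assume "x \<in> carrier (N \<times>\<times> M)" "y \<in> carrier (N \<times>\<times> M)"
    then obtain n h n' h' where xy: "x = (n, h)" "y = (n', h')"
      and c: "n \<in> carrier N" "h \<in> carrier M" "n' \<in> carrier N" "h' \<in> carrier M" by auto
    have "f n \<otimes> (g h \<otimes> f n') \<otimes> g h' = f n \<otimes> (f n' \<otimes> g h) \<otimes> g h'"
      using c by (simp add: comm)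
    then show "?F (x \<otimes>\<^bsub>N \<times>\<times> M\<^esub> y) = ?F x \<otimes> ?F y"
      using c by (simp add: xy m_assoc)
  qed auto
  interpret F: group_hom "N \<times>\<times> M" G ?F using hom by unfold_locales
  show "inj_on ?F (carrier (N \<times>\<times> M))"
    unfolding F.inj_on_one_iff
  proof (intro allI impI)
    fix x assume "x \<in> carrier (N \<times>\<times> M)" and eq: "?F x = \<one>"
    then obtain n h where x: "x = (n, h)" "n \<in> carrier N" "h \<in> carrier M" by auto
    have "f n = g (inv\<^bsub>M\<^esub> h)" using eq x by (simp add: inv_equality[symmetric])
    then have "f n = \<one>" "g h = \<one>" using triv[of n "inv\<^bsub>M\<^esub> h"] eq x by auto
    then show "x = \<one>\<^bsub>N \<times>\<times> M\<^esub>"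
      using x f(2) g(2) by (simp add: f.inj_on_one_iff g.inj_on_one_iff)
  qed
qed

end

abbreviation klein_four :: "(int \<times> int) monoid" where
  "klein_four \<equiv> integer_mod_group 2 \<times>\<times> integer_mod_group 2"

lemma group_klein_four: "group klein_four"
  by (intro DirProd_group group_integer_mod_group)

lemma carrier_klein_four: "carrier klein_four = {(0, 0), (0, 1), (1, 0), (1, 1)}"
  by (auto simp: carrier_Z2)

text \<open>
  For \<open>k = 1\<close> this is the automorphism of order 3 that maps \<open>(1, 0)\<close> to \<open>(0, 1)\<close>, \<open>(0, 1)\<close> to \<open>(1, 1)\<close>
  and \<open>(1, 1)\<close> to \<open>(1, 0)\<close>; for \<open>k = 2\<close> it is its inverse.
\<close>

definition klein_rotation :: "int \<Rightarrow> int \<times> int \<Rightarrow> int \<times> int" where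
  "klein_rotation k = (\<lambda>(i, j) \<in> carrier klein_four.
     if k = 0 then (i, j) else if k = 1 then (j, (i + j) mod 2) else ((i + j) mod 2, i))"

lemma klein_rotation_simps:
  "klein_rotation k (0, 0) = (0, 0)"
  "klein_rotation 0 (0, 1) = (0, 1)" "klein_rotation 0 (1, 0) = (1, 0)" "klein_rotation 0 (1, 1) = (1, 1)"
  "klein_rotation 1 (0, 1) = (1, 1)" "klein_rotation 1 (1, 0) = (0, 1)" "klein_rotation 1 (1, 1) = (1, 0)"
  "klein_rotation 2 (0, 1) = (1, 0)" "klein_rotation 2 (1, 0) = (1, 1)" "klein_rotation 2 (1, 1) = (0, 1)"
  by (simp_all add: klein_rotation_def carrier_klein_four del: carrier_DirProd)

lemma klein_rotation_hom: "klein_rotation \<in> hom (integer_mod_group 3) (AutoGroup klein_four)"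
proof -
  have ext: "klein_rotation k \<in> extensional (carrier klein_four)" for k
    by (simp add: klein_rotation_def)
  have add: "klein_rotation ((k + l) mod 3) v = klein_rotation k (klein_rotation l v)"
    if "k \<in> {0, 1, 2}" "l \<in> {0, 1, 2}" "v \<in> carrier klein_four" for k l v
    using that unfolding carrier_klein_four by (elim insertE emptyE) (simp_all add: klein_rotation_simps)
  have hom: "klein_rotation k \<in> hom klein_four klein_four" if "k \<in> {0, 1, 2}" for k
  proof (rule homI)
    fix v w assume vw: "v \<in> carrier klein_four" "w \<in> carrier klein_four"
    show "klein_rotation k v \<in> carrier klein_four"
      using that vw(1) unfolding carrier_klein_four
      by (elim insertE emptyE) (simp_all add: klein_rotation_simps)
    show "klein_rotation k (v \<otimes>\<^bsub>klein_four\<^esub> w) = klein_rotation k v \<otimes>\<^bsub>klein_four\<^esub> klein_rotation k w"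
      using that vw unfolding carrier_klein_four
      by (elim insertE emptyE) (simp_all add: klein_rotation_simps)
  qed
  have auto: "klein_rotation k \<in> auto klein_four" if k: "k \<in> {0, 1, 2}" for k
  proof -
    have k': "(- k) mod 3 \<in> {0, 1, 2}" using k by auto
    have "bij_betw (klein_rotation k) (carrier klein_four) (carrier klein_four)"
    proof (rule bij_betwI[of _ _ _ "klein_rotation ((- k) mod 3)"])
      fix v assume v: "v \<in> carrier klein_four"
      have "klein_rotation 0 v = v"
        using v by (auto simp: carrier_klein_four klein_rotation_simps simp del: carrier_DirProd)
      moreover have "(k + (- k) mod 3) mod 3 = 0" "((- k) mod 3 + k) mod 3 = 0"
        by (simp_all add: mod_simps)
      ultimately show "klein_rotation ((- k) mod 3) (klein_rotation k v) = v"
        "klein_rotation k (klein_rotation ((- k) mod 3) v) = v"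
        using add[OF k k' v] add[OF k' k v] by simp_all
    qed (use hom[OF k] hom[OF k'] in \<open>auto simp: hom_def simp del: carrier_DirProd\<close>)
    then show ?thesis using hom[OF k] ext by (simp add: auto_def Bij_def)
  qed
  show ?thesis
  proof (rule homI)
    fix k l assume kl: "k \<in> carrier (integer_mod_group 3)" "l \<in> carrier (integer_mod_group 3)"
    have "klein_rotation ((k + l) mod 3) = compose (carrier klein_four) (klein_rotation k) (klein_rotation l)"
      using kl add ext unfolding carrier_Z3
      by (intro extensionalityI[of _ "carrier klein_four"]) (auto simp: compose_def simp del: carrier_DirProd)
    then show "klein_rotation (k \<otimes>\<^bsub>integer_mod_group 3\<^esub> l) =
        klein_rotation k \<otimes>\<^bsub>AutoGroup klein_four\<^esub> klein_rotation l"
      using auto kl unfolding carrier_Z3 by (simp add: AutoGroup_def BijGroup_def auto_def)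
  qed (use auto in \<open>simp add: AutoGroup_def carrier_Z3\<close>)
qed

section \<open>Elements of order three\<close>

context group
begin

lemma inv_cancel_left:
  assumes "x \<in> carrier G" "y \<in> carrier G"
  shows "inv x \<otimes> (x \<otimes> y) = y" "x \<otimes> (inv x \<otimes> y) = y"
  using assms by (simp_all flip: m_assoc)

text \<open>
  Used as rewrite rules, together with \<open>inv_cancel_left\<close> and associativity, these reduce a word
  in elements of order 3 and their inverses.
\<close>

lemma cube_one_simps:
  assumes "a \<in> carrier G" "a \<otimes> a \<otimes> a = \<one>"
  shows "a \<otimes> a = inv a" "inv a \<otimes> inv a = a"
    "y \<in> carrier G \<Longrightarrow> a \<otimes> (a \<otimes> y) = inv a \<otimes> y"
    "y \<in> carrier G \<Longrightarrow> inv a \<otimes> (inv a \<otimes> y) = a \<otimes> y"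
proof -
  show 1: "a \<otimes> a = inv a" using assms by (metis inv_equality m_closed)
  then show 2: "inv a \<otimes> inv a = a" using assms by (metis inv_inv inv_mult_group)
  show "y \<in> carrier G \<Longrightarrow> a \<otimes> (a \<otimes> y) = inv a \<otimes> y"
    using assms 1 by (simp flip: m_assoc)
  show "y \<in> carrier G \<Longrightarrow> inv a \<otimes> (inv a \<otimes> y) = a \<otimes> y"
    using assms 2 by (simp flip: m_assoc)
qed

text \<open>
  The identity is included, so that these elements form a subgroup whenever they commute.
\<close>

definition cube_roots :: "'a set" where
  "cube_roots = {x \<in> carrier G. x \<otimes> x \<otimes> x = \<one>}"

lemma cube_roots_iff_pow: "x \<in> cube_roots \<longleftrightarrow> x \<in> carrier G \<and> x [^] (3::nat) = \<one>"
  by (auto simp: cube_roots_def numeral_3_eq_3)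

lemma cube_roots_eq: "cube_roots = insert \<one> {x \<in> carrier G. ord x = 3}"
proof -
  have "x [^] (3::nat) = \<one> \<longleftrightarrow> x = \<one> \<or> ord x = 3" if "x \<in> carrier G" for x
  proof -
    have "d dvd 3 \<longleftrightarrow> d = 1 \<or> d = 3" for d :: nat
    proof
      assume "d dvd 3"
      moreover from this have "d = 0 \<or> d = 1 \<or> d = 2 \<or> d = 3" using dvd_imp_le[of d 3] by linarith
      ultimately show "d = 1 \<or> d = 3" by auto
    qed auto
    then show ?thesis using that ord_eq_1 pow_eq_id by metis
  qed
  then show ?thesis by (auto simp: cube_roots_iff_pow)
qed

lemma klein_four_embedding:
  assumes u: "u \<in> carrier G" "u \<otimes> u = \<one>" "u \<noteq> \<one>" and v: "v \<in> carrier G" "v \<otimes> v = \<one>" "v \<noteq> \<one>"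
    and uv: "u \<otimes> v = v \<otimes> u" "u \<noteq> v"
  defines "f \<equiv> \<lambda>(i :: int, j :: int).
    if i = 0 then (if j = 0 then \<one> else v) else (if j = 0 then u else u \<otimes> v)"
  shows "f \<in> hom klein_four G" "inj_on f (carrier klein_four)"
proof -
  have uuv: "u \<otimes> (u \<otimes> v) = v" "v \<otimes> (u \<otimes> v) = u" "u \<otimes> v \<otimes> u = v" "u \<otimes> v \<otimes> v = u"
    "u \<otimes> v \<otimes> (u \<otimes> v) = \<one>"
  proof -
    show 1: "u \<otimes> (u \<otimes> v) = v" using u v by (simp flip: m_assoc)
    show 2: "u \<otimes> v \<otimes> v = u" using u v by (simp add: m_assoc)
    show "v \<otimes> (u \<otimes> v) = u" using 2 u v uv by (simp flip: m_assoc)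
    show "u \<otimes> v \<otimes> u = v" using 1 u v uv by (simp add: m_assoc)
    show "u \<otimes> v \<otimes> (u \<otimes> v) = \<one>" using 2 u v uv by (metis m_assoc m_closed)
  qed
  show "f \<in> hom klein_four G"
    by (intro homI) (use u v uv in \<open>auto simp: f_def carrier_klein_four uuv uv(1)[symmetric] simp del: carrier_DirProd\<close>)
  have "u \<otimes> v \<noteq> \<one>" using uuv(4) u v uv by (metis l_one)
  moreover have "u \<otimes> v \<noteq> u" "u \<otimes> v \<noteq> v" using u v by auto
  ultimately show "inj_on f (carrier klein_four)"
    unfolding f_def carrier_klein_four inj_on_def using u v uv
    by auto
qed

end

section \<open>Two non-commuting elements of order three\<close>

context group
begin

lemma cube_roots_conj:
  assumes "a \<in> carrier G" "x \<in> cube_roots"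
  shows "a \<otimes> x \<otimes> inv a \<in> cube_roots" "inv (a \<otimes> x \<otimes> inv a) = a \<otimes> inv x \<otimes> inv a"
proof -
  have x: "x \<in> carrier G" "x \<otimes> x \<otimes> x = \<one>" using assms by (auto simp: cube_roots_def)
  show "a \<otimes> x \<otimes> inv a \<in> cube_roots"
    using assms(1) x cube_one_simps[OF x] by (simp add: cube_roots_def m_assoc inv_cancel_left)
  show "inv (a \<otimes> x \<otimes> inv a) = a \<otimes> inv x \<otimes> inv a"
    using assms(1) x by (simp add: inv_mult_group m_assoc)
qed

text \<open>
  Conjugating \<open>x\<close> three times by \<open>a\<close> gives \<open>x\<close> back, but three inversions give the inverse of \<open>x\<close>.
\<close>

lemma cube_root_conj_ne_inv:
  assumes a: "a \<in> cube_roots" and x: "x \<in> cube_roots" "x \<noteq> \<one>"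
  shows "a \<otimes> x \<otimes> inv a \<noteq> inv x"
proof
  assume eq: "a \<otimes> x \<otimes> inv a = inv x"
  have c: "a \<in> carrier G" "a \<otimes> a \<otimes> a = \<one>" "x \<in> carrier G" "x \<otimes> x \<otimes> x = \<one>"
    using a x by (auto simp: cube_roots_def)
  note s = cube_one_simps[OF c(1,2)] inv_cancel_left m_assoc
  have "a \<otimes> inv x \<otimes> inv a = x" using cube_roots_conj(2)[OF c(1) x(1)] eq c by simp
  then have "a \<otimes> (a \<otimes> (a \<otimes> x \<otimes> inv a) \<otimes> inv a) \<otimes> inv a = inv x"
    using eq by simp
  moreover have "a \<otimes> (a \<otimes> (a \<otimes> x \<otimes> inv a) \<otimes> inv a) \<otimes> inv a = x"
    using c by (simp add: s)
  ultimately have "x \<otimes> x = \<one>" using c by (metis r_inv)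
  then show False using c x(2) by simp
qed

lemma noncommuting_cube_root_ne:
  assumes a: "a \<in> cube_roots" and x: "x \<in> cube_roots" "a \<otimes> x \<noteq> x \<otimes> a"
  shows "x \<notin> {\<one>, a, inv a}" "inv x \<notin> {\<one>, a, inv a}" "x \<noteq> inv x"
    "a \<otimes> x \<otimes> inv a \<notin> {x, inv x}"
    "a \<otimes> (a \<otimes> x \<otimes> inv a) \<noteq> (a \<otimes> x \<otimes> inv a) \<otimes> a"
proof -
  have c: "a \<in> carrier G" "a \<otimes> a \<otimes> a = \<one>" "x \<in> carrier G" "x \<otimes> x \<otimes> x = \<one>"
    using a x by (auto simp: cube_roots_def)
  show 1: "x \<notin> {\<one>, a, inv a}" using x(2) c by auto
  show "inv x \<notin> {\<one>, a, inv a}"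
    using 1 c inv_inv[OF c(1)] inv_inv[OF c(3)] by (metis insert_iff inv_one singletonD)
  show "x \<noteq> inv x"
    using 1 c cube_one_simps(1)[OF c(3,4)] by (metis insertI1 l_cancel_one)
  have "a \<otimes> x \<otimes> inv a \<noteq> x"
  proof
    assume "a \<otimes> x \<otimes> inv a = x"
    then have "a \<otimes> x \<otimes> inv a \<otimes> a = x \<otimes> a" by simp
    then show False using x(2) c by (simp add: m_assoc)
  qed
  then show "a \<otimes> x \<otimes> inv a \<notin> {x, inv x}" using cube_root_conj_ne_inv[OF a x(1)] 1 by auto
  show "a \<otimes> (a \<otimes> x \<otimes> inv a) \<noteq> (a \<otimes> x \<otimes> inv a) \<otimes> a"
  proof
    assume "a \<otimes> (a \<otimes> x \<otimes> inv a) = (a \<otimes> x \<otimes> inv a) \<otimes> a"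
    then have "inv a \<otimes> (a \<otimes> (a \<otimes> x \<otimes> inv a)) \<otimes> a = inv a \<otimes> ((a \<otimes> x \<otimes> inv a) \<otimes> a) \<otimes> a" by simp
    then show False using x(2) c by (simp add: m_assoc inv_cancel_left)
  qed
qed

text \<open>
  The nine elements on the right are distinct: conjugation by \<open>a\<close> permutes \<open>b\<close> and its two conjugates
  cyclically, and by \<open>cube_root_conj_ne_inv\<close> it never maps an element to its own inverse.
\<close>

lemma noncommuting_cube_roots_eq:
  assumes fin: "finite (carrier G)" and card: "card cube_roots \<le> 9"
    and a: "a \<in> cube_roots" and b: "b \<in> cube_roots" "a \<otimes> b \<noteq> b \<otimes> a"
  shows "cube_roots = {\<one>, a, inv a, b, inv b, a \<otimes> b \<otimes> inv a, a \<otimes> inv b \<otimes> inv a,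
    inv a \<otimes> b \<otimes> a, inv a \<otimes> inv b \<otimes> a}"
proof -
  have c: "a \<in> carrier G" "a \<otimes> a \<otimes> a = \<one>" "b \<in> carrier G" "b \<otimes> b \<otimes> b = \<one>"
    using a b by (auto simp: cube_roots_def)
  define c1 where "c1 = a \<otimes> b \<otimes> inv a"
  define c2 where "c2 = a \<otimes> c1 \<otimes> inv a"
  note s = cube_one_simps[OF c(1,2)] inv_cancel_left m_assoc
  have c1: "c1 \<in> cube_roots" "a \<otimes> c1 \<noteq> c1 \<otimes> a" "inv c1 = a \<otimes> inv b \<otimes> inv a"
    using cube_roots_conj[OF c(1) b(1)] noncommuting_cube_root_ne(5)[OF a b] by (auto simp: c1_def)
  have c2: "c2 \<in> cube_roots" "a \<otimes> c2 \<noteq> c2 \<otimes> a" "inv c2 = a \<otimes> inv c1 \<otimes> inv a"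
    using cube_roots_conj[OF c(1) c1(1)] noncommuting_cube_root_ne(5)[OF a c1(1,2)] by (auto simp: c2_def)
  have c2_eq: "c2 = inv a \<otimes> b \<otimes> a" "inv c2 = inv a \<otimes> inv b \<otimes> a"
    unfolding c2(3) c1(3) using c by (simp_all add: c2_def c1_def s)
  have "a \<otimes> c2 \<otimes> inv a = b" using c by (simp add: c2_eq s)
  then have ne: "c1 \<notin> {b, inv b}" "c2 \<notin> {c1, inv c1}" "b \<notin> {c2, inv c2}"
    using noncommuting_cube_root_ne(4)[OF a b] noncommuting_cube_root_ne(4)[OF a c1(1,2)]
      noncommuting_cube_root_ne(4)[OF a c2(1,2)] by (auto simp: c1_def c2_def)
  have car: "c1 \<in> carrier G" "c2 \<in> carrier G" using c1(1) c2(1) by (auto simp: cube_roots_def)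
  have ne': "inv x \<noteq> y" "inv x \<noteq> inv y" "x \<noteq> y" "y \<noteq> x" "inv y \<noteq> x" "inv y \<noteq> inv x" "x \<noteq> inv y" "y \<noteq> inv x"
    if "x \<notin> {y, inv y}" "x \<in> carrier G" "y \<in> carrier G" for x y
    using that by auto
  have "a \<noteq> \<one>" using b c by auto
  then have a_ne: "inv a \<noteq> \<one>" "a \<noteq> inv a"
    using c cube_one_simps(1)[OF c(1,2)] by (metis inv_eq_1_iff, metis l_cancel_one)
  let ?xs = "[\<one>, a, inv a, b, inv b, c1, inv c1, c2, inv c2]"
  have "distinct ?xs"
    using \<open>a \<noteq> \<one>\<close> a_ne ne'[OF ne(1) car(1) c(3)] ne'[OF ne(2) car(2,1)] ne'[OF ne(3) c(3) car(2)]
      noncommuting_cube_root_ne(1-3)[OF a b] noncommuting_cube_root_ne(1-3)[OF a c1(1,2)]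
      noncommuting_cube_root_ne(1-3)[OF a c2(1,2)]
    by (simp only: distinct.simps set_simps insert_iff empty_iff) metis
  then have "card (set ?xs) = 9" by (simp only: distinct_card) simp
  moreover have "inv x \<in> cube_roots" if "x \<in> cube_roots" for x
    using that by (auto simp: cube_roots_iff_pow nat_pow_inv)
  then have "set ?xs \<subseteq> cube_roots" using a b c1(1) c2(1) by (auto simp: cube_roots_def)
  moreover have "finite cube_roots" using fin by (simp add: cube_roots_def)
  ultimately have "set ?xs = cube_roots" using card by (intro card_seteq) simp_all
  then show ?thesis unfolding c2_eq(2) c1(3) set_simps unfolding c2_eq(1) c1_def by (rule sym)
qed

text \<open>
  The product \<open>a \<otimes> b\<close> is one of the nine elements of \<open>noncommuting_cube_roots_eq\<close>. All possibilities are
  absurd except \<open>a \<otimes> b = inv a \<otimes> inv b \<otimes> a\<close>, which is the claimed relation.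
\<close>

lemma noncommuting_cube_roots_product:
  assumes fin: "finite (carrier G)" and card: "card cube_roots \<le> 9"
    and a: "a \<in> cube_roots" and b: "b \<in> cube_roots" "a \<otimes> b \<noteq> b \<otimes> a" and ab: "a \<otimes> b \<in> cube_roots"
  shows "(inv a \<otimes> b) \<otimes> (inv a \<otimes> b) = \<one>"
proof -
  have c: "a \<in> carrier G" "a \<otimes> a \<otimes> a = \<one>" "b \<in> carrier G" "b \<otimes> b \<otimes> b = \<one>"
    using a b by (auto simp: cube_roots_def)
  note s = cube_one_simps[OF c(1,2)] cube_one_simps[OF c(3,4)] inv_cancel_left m_assoc
  note ne = noncommuting_cube_root_ne[OF a b]
  have "a \<noteq> \<one>" using b c by auto
  have L: "inv a \<otimes> (a \<otimes> b) = b" "(a \<otimes> b) \<otimes> inv b = a" using c by (simp_all add: s)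
  consider "a \<otimes> b \<in> {\<one>, a, inv a}" | "a \<otimes> b \<in> {b, inv b}" | "a \<otimes> b = a \<otimes> b \<otimes> inv a"
    | "a \<otimes> b = a \<otimes> inv b \<otimes> inv a" | "a \<otimes> b = inv a \<otimes> b \<otimes> a" | "a \<otimes> b = inv a \<otimes> inv b \<otimes> a"
    using ab noncommuting_cube_roots_eq[OF fin card a b] by auto
  then show ?thesis
  proof cases
    case 1
    then have "b \<in> {inv a \<otimes> \<one>, inv a \<otimes> a, inv a \<otimes> inv a}" using L(1) by auto
    then show ?thesis using ne(1) c by (auto simp: s)
  next
    case 2
    then have "a \<in> {b \<otimes> inv b, inv b \<otimes> inv b}" using L(2) by auto
    then show ?thesis using ne(1) \<open>a \<noteq> \<one>\<close> c by (auto simp: s)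
  next
    case 3
    then have "inv b \<otimes> (inv a \<otimes> (a \<otimes> b)) = inv b \<otimes> (inv a \<otimes> (a \<otimes> b \<otimes> inv a))" by simp
    then have "\<one> = inv a" using c by (simp add: s)
    then show ?thesis using \<open>a \<noteq> \<one>\<close> c by (simp add: one_eq_inv_iff)
  next
    case 4
    then have "b \<otimes> (inv a \<otimes> (a \<otimes> b)) = b \<otimes> (inv a \<otimes> (a \<otimes> inv b \<otimes> inv a))" by simp
    then have "inv b = inv a" using c by (simp add: s)
    then show ?thesis using ne(2) by simp
  next
    case 5
    \<comment> \<open>Conjugation by \<open>b\<close> would invert \<open>a\<close>.\<close>
    then have "a \<otimes> (a \<otimes> b) \<otimes> inv b = a \<otimes> (inv a \<otimes> b \<otimes> a) \<otimes> inv b" by simp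
    then have "b \<otimes> a \<otimes> inv b = inv a" using c by (simp add: s)
    then show ?thesis using cube_root_conj_ne_inv[OF b(1) a \<open>a \<noteq> \<one>\<close>] by simp
  next
    case 6
    then have "a \<otimes> (a \<otimes> b) \<otimes> (inv a \<otimes> b) = a \<otimes> (inv a \<otimes> inv b \<otimes> a) \<otimes> (inv a \<otimes> b)" by simp
    then show ?thesis using c by (simp add: s)
  qed
qed

text \<open>
  Either \<open>a \<otimes> b\<close> is an involution or, by \<open>noncommuting_cube_roots_product\<close>, \<open>inv a \<otimes> b\<close> satisfies the
  relation, so that \<open>a\<close> can be replaced by its inverse. The last clause holds because all nine cube roots of
  unity are words in the two generators.
\<close>

lemma exists_alt4_generators:
  assumes fin: "finite (carrier G)" and card: "card cube_roots \<le> 9"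
    and exp: "\<forall>x \<in> carrier G - cube_roots. x \<otimes> x = \<one>"
    and a: "a \<in> cube_roots" and b: "b \<in> cube_roots" "a \<otimes> b \<noteq> b \<otimes> a"
  shows "\<exists>a. a \<in> cube_roots \<and> (a \<otimes> b) \<otimes> (a \<otimes> b) = \<one> \<and> a \<otimes> b \<noteq> b \<otimes> a \<and>
    (\<forall>M. subgroup M G \<and> a \<in> M \<and> b \<in> M \<longrightarrow> cube_roots \<subseteq> M)"
proof -
  have c: "a \<in> carrier G" "a \<otimes> a \<otimes> a = \<one>" "b \<in> carrier G"
    using a b by (auto simp: cube_roots_def)
  have gen: "cube_roots \<subseteq> M" if "subgroup M G" "a \<in> M" "b \<in> M" for M
    unfolding noncommuting_cube_roots_eq[OF fin card a b]
    using that by (simp add: subgroup.one_closed subgroup.m_closed subgroup.m_inv_closed)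
  show ?thesis
  proof (cases "a \<otimes> b \<in> cube_roots")
    case False
    then show ?thesis using exp c a b gen by (intro exI[of _ a]) auto
  next
    case True
    have "inv a \<otimes> b \<noteq> b \<otimes> inv a"
    proof
      assume "inv a \<otimes> b = b \<otimes> inv a"
      then have "a \<otimes> (inv a \<otimes> b) \<otimes> a = a \<otimes> (b \<otimes> inv a) \<otimes> a" by simp
      then show False using b(2) c by (simp add: m_assoc inv_cancel_left)
    qed
    moreover have "inv a \<in> cube_roots" using a by (auto simp: cube_roots_iff_pow nat_pow_inv)
    moreover have "cube_roots \<subseteq> M" if "subgroup M G" "inv a \<in> M" "b \<in> M" for M
      using gen[of M] that subgroup.m_inv_closed[OF that(1,2)] c by simp
    ultimately show ?thesis
      using noncommuting_cube_roots_product[OF fin card a b True] by (intro exI[of _ "inv a"]) blast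
  qed
qed

text \<open>
  The relations \<open>a\<^sup>3 = b\<^sup>3 = (ab)\<^sup>2 = 1\<close> present the alternating group of degree 4. Conjugation by \<open>a\<close> permutes
  \<open>u = ab\<close>, \<open>v = a\<^sup>-\<^sup>1ba\<^sup>-\<^sup>1\<close> and \<open>w = ba\<close> cyclically. The relations yield \<open>uv = w\<close>, so that these three
  involutions and the identity form a Klein four-group normalised by \<open>a\<close>, and \<open>b = wa\<^sup>-\<^sup>1\<close>.
\<close>

lemma alt4_presentation_embedding:
  assumes a: "a \<in> carrier G" "a \<otimes> a \<otimes> a = \<one>" and b: "b \<in> carrier G" "b \<otimes> b \<otimes> b = \<one>"
    and ab: "(a \<otimes> b) \<otimes> (a \<otimes> b) = \<one>" "a \<otimes> b \<noteq> b \<otimes> a"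
  shows "\<exists>F. F \<in> hom (semidirect_product klein_four (integer_mod_group 3) klein_rotation) G \<and>
    inj_on F (carrier klein_four \<times> carrier (integer_mod_group 3)) \<and>
    a \<in> F ` (carrier klein_four \<times> carrier (integer_mod_group 3)) \<and>
    b \<in> F ` (carrier klein_four \<times> carrier (integer_mod_group 3))"
proof -
  note sa = cube_one_simps[OF a] inv_cancel_left m_assoc
  note s = sa cube_one_simps[OF b]
  define u v w where "u = a \<otimes> b" and "v = inv a \<otimes> b \<otimes> inv a" and "w = b \<otimes> a"
  have c: "u \<in> carrier G" "v \<in> carrier G" "w \<in> carrier G" using a b by (auto simp: u_def v_def w_def)
  have conj: "a \<otimes> u = v \<otimes> a" "a \<otimes> v = w \<otimes> a" "a \<otimes> w = u \<otimes> a"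
    "inv a \<otimes> u = w \<otimes> inv a" "inv a \<otimes> v = u \<otimes> inv a" "inv a \<otimes> w = v \<otimes> inv a"
    using a b by (simp_all add: u_def v_def w_def s)
  have uu: "u \<otimes> u = \<one>" using ab by (simp add: u_def)
  have conj': "v = a \<otimes> u \<otimes> inv a" "w = a \<otimes> v \<otimes> inv a" "u = a \<otimes> w \<otimes> inv a"
    using a b by (simp_all add: u_def v_def w_def s)
  have vv: "v \<otimes> v = \<one>"
  proof -
    have "v \<otimes> v = a \<otimes> (u \<otimes> u) \<otimes> inv a" unfolding conj'(1) using a c by (simp add: m_assoc inv_cancel_left)
    then show ?thesis using uu a by simp
  qed
  have ww: "w \<otimes> w = \<one>"
  proof -
    have "w \<otimes> w = a \<otimes> (v \<otimes> v) \<otimes> inv a" unfolding conj'(2) using a c by (simp add: m_assoc inv_cancel_left)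
    then show ?thesis using vv a by simp
  qed
  have aba: "a \<otimes> b \<otimes> a = inv b"
    using ab a b by (intro inv_equality[symmetric]) (simp_all add: m_assoc)
  have uv: "u \<otimes> v = w"
  proof -
    have "b \<otimes> a \<otimes> b = inv a" using ww[unfolded w_def] a b
      by (intro inv_equality[symmetric]) (simp_all add: m_assoc)
    then have "u \<otimes> v = a \<otimes> b \<otimes> (b \<otimes> a \<otimes> b) \<otimes> b \<otimes> inv a"
      using a b by (simp add: u_def v_def m_assoc)
    also have "\<dots> = a \<otimes> inv b \<otimes> (a \<otimes> inv b \<otimes> inv a)" using a b by (simp add: s)
    also have "\<dots> = a \<otimes> (a \<otimes> b \<otimes> a) \<otimes> (a \<otimes> (a \<otimes> b \<otimes> a) \<otimes> inv a)" by (simp only: aba)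
    also have "\<dots> = inv (b \<otimes> a)" using a b by (simp add: s inv_mult_group)
    also have "\<dots> = w" using ww a b by (intro inv_equality) (auto simp: w_def)
    finally show ?thesis .
  qed
  have vu: "v \<otimes> u = w"
  proof -
    have "v \<otimes> u = inv (u \<otimes> v)" using uu vv c by (metis inv_equality inv_mult_group)
    also have "\<dots> = w" unfolding uv using ww c by (intro inv_equality) auto
    finally show ?thesis .
  qed
  have u1: "u \<noteq> \<one>"
  proof
    assume "u = \<one>"
    then have "b = inv a" using a b by (metis inv_equality inv_inv u_def)
    then show False using ab(2) a by simp
  qed
  have v1: "v \<noteq> \<one>"
  proof
    assume "v = \<one>"
    then have "a \<otimes> u = a" using conj(1) a by simp
    then show False using u1 a c by simp
  qed
  have w1: "w \<noteq> \<one>"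
  proof
    assume "w = \<one>"
    then have "a \<otimes> v = a" using conj(2) a by simp
    then show False using v1 a c by simp
  qed
  have "u \<noteq> v" using uv uu w1 by auto
  define f where "f = (\<lambda>(i :: int, j :: int).
    if i = 0 then (if j = 0 then \<one> else v) else (if j = 0 then u else u \<otimes> v))"
  have f: "f \<in> hom klein_four G" "inj_on f (carrier klein_four)"
    unfolding f_def using c uu vv u1 v1 uv vu \<open>u \<noteq> v\<close> by (intro klein_four_embedding; simp)+
  have f_simps: "f (0, 0) = \<one>" "f (0, 1) = v" "f (1, 0) = u" "f (1, 1) = w"
    by (simp_all add: f_def uv)
  define g where "g k = a [^] (k :: int)" for k
  have "a \<noteq> \<one>" using ab b by auto
  then have ord: "ord a = 3" using a cube_roots_eq by (auto simp: cube_roots_def)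
  have g: "g \<in> hom (integer_mod_group 3) G" "inj_on g (carrier (integer_mod_group 3))"
    unfolding g_def using int_pow_hom_integer_mod_group[of a 3] int_pow_inj_integer_mod_group[of a] a ord
    by (auto simp: numeral_3_eq_3)
  have g2: "g 2 = inv a"
    using int_pow_mult[OF a(1), of 1 1] a by (simp add: g_def sa)
  have g_simps: "g 0 = \<one>" "g 1 = a" using a by (simp_all add: g_def)
  have cases: "n \<in> {(0, 0), (0, 1), (1, 0), (1, 1)} \<and> h \<in> {0, 1, 2}"
    if "n \<in> carrier klein_four" "h \<in> carrier (integer_mod_group 3)" for n h
    using that unfolding carrier_klein_four carrier_Z3 by simp
  have *: "g h \<otimes> f n = f (klein_rotation h n) \<otimes> g h"
    if "n \<in> carrier klein_four" "h \<in> carrier (integer_mod_group 3)" for n h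
    using cases[OF that] a c
    by (elim conjE insertE emptyE) (simp_all add: klein_rotation_simps f_simps g_simps g2 conj)
  have **: "f n = \<one>"
    if "n \<in> carrier klein_four" "h \<in> carrier (integer_mod_group 3)" "f n = g h" for n h
  proof -
    have "f n \<otimes> f n = \<one>" "g h \<otimes> g h \<otimes> g h = \<one>" "f n \<in> carrier G"
      using cases[OF that(1,2)] a c uu vv ww
      by (auto simp: f_simps g_simps g2 cube_one_simps[OF a])
    then show ?thesis using that(3) by simp
  qed
  note F = semidirect_product_embedding[OF group_klein_four group_integer_mod_group klein_rotation_hom f g * **]
  let ?F = "\<lambda>(n, h). f n \<otimes> g h"
  have "a = ?F ((0, 0), 1)" using a by (simp add: f_simps g_simps)
  moreover have "b = ?F ((1, 1), 2)" using a b by (simp add: f_simps g2 w_def m_assoc)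
  ultimately have "a \<in> ?F ` (carrier klein_four \<times> carrier (integer_mod_group 3))"
    "b \<in> ?F ` (carrier klein_four \<times> carrier (integer_mod_group 3))"
    unfolding carrier_klein_four carrier_Z3 by blast+
  then show ?thesis using F by (intro exI[of _ ?F]) simp
qed

end

section \<open>Groups with element orders at most four\<close>

lemma card_Z3: "card (carrier (integer_mod_group 3)) = 3"
  by (simp add: carrier_Z3)

context group
begin

lemma int_pow_embedding:
  assumes a: "a \<in> carrier G" and n: "ord a = n" "0 < n"
  shows "(\<lambda>i::int. a [^] i) \<in> hom (integer_mod_group n) G"
    and "inj_on (\<lambda>i::int. a [^] i) (carrier (integer_mod_group n))"
  using int_pow_hom_integer_mod_group[OF a, of n] int_pow_inj_integer_mod_group[OF a] a n by auto

lemma int_pow_image_Z3: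
  assumes a: "a \<in> carrier G" "a \<otimes> a \<otimes> a = \<one>"
  shows "(\<lambda>i::int. a [^] i) ` carrier (integer_mod_group 3) = {\<one>, a, inv a}"
proof -
  have "a [^] (2::int) = inv a"
    using int_pow_mult[OF a(1), of 1 1] a cube_one_simps(1)[OF a] by simp
  then show ?thesis using a by (simp add: carrier_Z3)
qed

text \<open>
  If the powers of \<open>a\<close> do not exhaust the cube roots of unity, then with a further element \<open>b\<close> the nine
  products \<open>a\<^sup>ib\<^sup>j\<close> do.
\<close>

lemma commuting_cube_roots_structure:
  assumes fin: "finite (carrier G)" and card: "card cube_roots \<le> 9"
    and comm: "\<forall>x \<in> cube_roots. \<forall>y \<in> cube_roots. x \<otimes> y = y \<otimes> x"
    and a: "a \<in> cube_roots" "a \<noteq> \<one>"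
  shows "(\<exists>f. f \<in> hom (integer_mod_group 3) G \<and> inj_on f (carrier (integer_mod_group 3)) \<and>
      f ` carrier (integer_mod_group 3) = cube_roots) \<or>
    (\<exists>f. f \<in> hom (integer_mod_group 3 \<times>\<times> integer_mod_group 3) G \<and>
      inj_on f (carrier (integer_mod_group 3 \<times>\<times> integer_mod_group 3)) \<and>
      f ` carrier (integer_mod_group 3 \<times>\<times> integer_mod_group 3) = cube_roots)"
proof -
  let ?Z = "integer_mod_group 3"
  define f where "f = (\<lambda>x (i :: int). x [^] i)"
  have f: "f x \<in> hom ?Z G" "inj_on (f x) (carrier ?Z)" "f x ` carrier ?Z = {\<one>, x, inv x}"
    and x: "x \<in> carrier G" "x \<otimes> x \<otimes> x = \<one>" "inv x \<in> cube_roots"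
    if "x \<in> cube_roots" "x \<noteq> \<one>" for x
  proof -
    show x: "x \<in> carrier G" "x \<otimes> x \<otimes> x = \<one>" using that by (auto simp: cube_roots_def)
    show "inv x \<in> cube_roots" using that by (auto simp: cube_roots_iff_pow nat_pow_inv)
    have "ord x = 3" using that cube_roots_eq by auto
    then show "f x \<in> hom ?Z G" "inj_on (f x) (carrier ?Z)" "f x ` carrier ?Z = {\<one>, x, inv x}"
      using int_pow_embedding[of x 3] int_pow_image_Z3[of x] x by (simp_all add: f_def)
  qed
  have one: "\<one> \<in> cube_roots" by (simp add: cube_roots_def)
  show ?thesis
  proof (cases "cube_roots \<subseteq> {\<one>, a, inv a}")
    case True
    then have "f a ` carrier ?Z = cube_roots" using f(3)[OF a] x[OF a] a one by auto
    then show ?thesis using f[OF a] by blast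
  next
    case False
    then obtain b where b: "b \<in> cube_roots" "b \<notin> {\<one>, a, inv a}" by blast
    then have b1: "b \<noteq> \<one>" by simp
    note fb = f[OF b(1) b1] and xb = x[OF b(1) b1] and fa = f[OF a] and xa = x[OF a]
    have in_a: "f a n \<in> {\<one>, a, inv a}" and in_b: "f b n \<in> {\<one>, b, inv b}"
      if "n \<in> carrier ?Z" for n
      using that fa(3) fb(3) by blast+
    have commute: "f b m \<otimes> f a n = f a n \<otimes> f b m" if "n \<in> carrier ?Z" "m \<in> carrier ?Z" for n m
    proof -
      have "f a n \<in> cube_roots" "f b m \<in> cube_roots"
        using in_a[OF that(1)] in_b[OF that(2)] a b xa xb one by auto
      then show ?thesis using comm by blast
    qed
    have triv: "f a n = \<one>" if nm: "n \<in> carrier ?Z" "m \<in> carrier ?Z" and eq: "f a n = f b m" for n m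
    proof (rule ccontr)
      assume "f a n \<noteq> \<one>"
      then have "b = f b m \<or> b = inv (f b m)" using in_b[OF nm(2)] eq xb by auto
      then show False using eq in_a[OF nm(1)] xa b(2) by auto
    qed
    let ?F = "\<lambda>(n, m). f a n \<otimes> f b m"
    have F: "?F \<in> hom (?Z \<times>\<times> ?Z) G" "inj_on ?F (carrier (?Z \<times>\<times> ?Z))"
      using DirProd_embedding[OF group_integer_mod_group group_integer_mod_group fa(1,2) fb(1,2)
          commute triv] by simp_all
    have "?F ` carrier (?Z \<times>\<times> ?Z) = cube_roots"
    proof (rule card_seteq)
      show "finite cube_roots" using fin by (simp add: cube_roots_def)
      have mult: "x \<otimes> y \<in> cube_roots" if "x \<in> cube_roots" "y \<in> cube_roots" for x y
      proof -
        have xy: "x \<otimes> y = y \<otimes> x" using that comm by blast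
        have c: "x \<in> carrier G" "y \<in> carrier G" using that by (simp_all add: cube_roots_def)
        show ?thesis
          using pow_mult_distrib[OF xy c, of 3] that c by (simp add: cube_roots_iff_pow)
      qed
      have "f a n \<otimes> f b m \<in> cube_roots" if "n \<in> carrier ?Z" "m \<in> carrier ?Z" for n m
        using in_a[OF that(1)] in_b[OF that(2)] a b xa xb one by (intro mult) auto
      then show "?F ` carrier (?Z \<times>\<times> ?Z) \<subseteq> cube_roots" by auto
      show "card cube_roots \<le> card (?F ` carrier (?Z \<times>\<times> ?Z))"
        using card card_image[OF F(2)] by (simp add: card_cartesian_product card_Z3)
    qed
    then show ?thesis using F by blast
  qed
qed

text \<open>
  If the cube roots of unity commute, they form a subgroup whose complement consists of involutions.
  Otherwise the same holds for the subgroup generated by two of them as in \<open>exists_alt4_generators\<close>, which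
  contains all cube roots of unity; since it is not abelian, its complement is empty.
\<close>

lemma structure_of_orders_123:
  assumes fin: "finite (carrier G)" and card: "card cube_roots \<le> 9"
    and exp: "\<forall>x \<in> carrier G - cube_roots. x \<otimes> x = \<one>" and a: "a \<in> cube_roots" "a \<noteq> \<one>"
  shows "cube_roots = carrier G \<and>
      (G \<cong> integer_mod_group 3 \<or> G \<cong> integer_mod_group 3 \<times>\<times> integer_mod_group 3) \<or>
    cube_roots \<noteq> carrier G \<and>
      (G \<cong> dihedral_group 3 \<or>
       is_semidirect_product G (integer_mod_group 3 \<times>\<times> integer_mod_group 3) (integer_mod_group 2) \<or>
       G \<cong> semidirect_product klein_four (integer_mod_group 3) klein_rotation)"
proof (cases "\<forall>x \<in> cube_roots. \<forall>y \<in> cube_roots. x \<otimes> y = y \<otimes> x")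
  case True
  let ?Z = "integer_mod_group 3"
  have comm: "comm_group (?Z \<times>\<times> ?Z)"
    by (rule group.group_comm_groupI) (auto simp: DirProd_group add.commute)
  have aa: "a \<otimes> a \<noteq> \<one>" using a by (auto simp: cube_roots_def)
  \<comment> \<open>Either the cube roots of unity exhaust the group, or they have index 2.\<close>
  have split: "cube_roots = carrier G \<and> G \<cong> N \<or>
      cube_roots \<noteq> carrier G \<and> G \<cong> semidirect_product N (integer_mod_group 2) (inversion_action N)"
    if N: "comm_group N" and f: "f \<in> hom N G" "inj_on f (carrier N)" "f ` carrier N = cube_roots"
    for N :: "('c, 'd) monoid_scheme" and f
  proof (cases "cube_roots = carrier G")
    case True
    then show ?thesis using f is_iso_of_embedding[of N f] N by (simp add: comm_group.axioms(2))
  next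
    case False
    then obtain t where "t \<in> carrier G" "t \<notin> f ` carrier N" using f(3) by (auto simp: cube_roots_def)
    then show ?thesis
      using iso_of_involution_complement[OF N f(1,2), of t a] exp a aa f(3) False by simp
  qed
  from commuting_cube_roots_structure[OF fin card True a] show ?thesis
  proof (elim disjE exE conjE)
    fix f assume "f \<in> hom ?Z G" "inj_on f (carrier ?Z)" "f ` carrier ?Z = cube_roots"
    from split[OF abelian_integer_mod_group this] show ?thesis unfolding dihedral_group_eq by blast
  next
    fix f assume "f \<in> hom (?Z \<times>\<times> ?Z) G" "inj_on f (carrier (?Z \<times>\<times> ?Z))" "f ` carrier (?Z \<times>\<times> ?Z) = cube_roots"
    from split[OF comm this] show ?thesis
      unfolding is_semidirect_product_def using comm_group.inversion_action_hom[OF comm] by blast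
  qed
next
  case False
  let ?S = "semidirect_product klein_four (integer_mod_group 3) klein_rotation"
  let ?C = "carrier klein_four \<times> carrier (integer_mod_group 3)"
  obtain a b where ab: "a \<in> cube_roots" "b \<in> cube_roots" "(a \<otimes> b) \<otimes> (a \<otimes> b) = \<one>" "a \<otimes> b \<noteq> b \<otimes> a"
    and gen: "\<And>M. subgroup M G \<Longrightarrow> a \<in> M \<Longrightarrow> b \<in> M \<Longrightarrow> cube_roots \<subseteq> M"
    using False exists_alt4_generators[OF fin card exp] by blast
  have c: "a \<in> carrier G" "a \<otimes> a \<otimes> a = \<one>" "b \<in> carrier G" "b \<otimes> b \<otimes> b = \<one>"
    using ab by (auto simp: cube_roots_def)
  obtain F where F: "F \<in> hom ?S G" "inj_on F ?C" "a \<in> F ` ?C" "b \<in> F ` ?C"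
    using alt4_presentation_embedding[OF c ab(3,4)] by blast
  have S: "group ?S" by (intro group_semidirect_product group_klein_four group_integer_mod_group klein_rotation_hom)
  interpret F: group_hom ?S G F
    using S F(1) group_axioms by (simp add: group_hom_def group_hom_axioms_def)
  have M: "subgroup (F ` ?C) G" using F.img_is_subgroup by simp
  have sub: "cube_roots \<subseteq> F ` ?C" by (rule gen[OF M F(3,4)])
  \<comment> \<open>An element outside the image would make the image abelian.\<close>
  have "carrier G \<subseteq> F ` ?C"
  proof
    fix t assume t: "t \<in> carrier G"
    show "t \<in> F ` ?C"
    proof (rule ccontr)
      assume "t \<notin> F ` ?C"
      then have "a \<otimes> b = b \<otimes> a"
        using involution_complement_commute[OF M _ t _ F(3,4)] exp sub by blast
      then show False using ab(4) by simp
    qed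
  qed
  then have "G \<cong> ?S" using F S by (intro is_iso_of_embedding) auto
  moreover have "a \<otimes> b \<notin> cube_roots"
  proof
    assume "a \<otimes> b \<in> cube_roots"
    then have "a \<otimes> b = \<one>" using ab(3) c by (simp add: cube_roots_def)
    then show False using ab(4) c by (metis inv_equality r_inv)
  qed
  ultimately show ?thesis using c by blast
qed

text \<open>
  The cyclic subgroup generated by \<open>c\<close> contains all elements of order 4, so its complement consists of
  involutions.
\<close>

lemma structure_of_orders_124:
  assumes ords: "\<And>x. x \<in> carrier G \<Longrightarrow> ord x \<in> {1, 2, 4}" and fin: "finite (carrier G)"
    and card: "card {x \<in> carrier G. ord x = 4} \<le> 2" and c: "c \<in> carrier G" "ord c = 4"
  shows "G \<cong> integer_mod_group 4 \<or> G \<cong> dihedral_group 4"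
proof -
  let ?Z = "integer_mod_group 4"
  define f where "f = (\<lambda>i :: int. c [^] i)"
  have f: "f \<in> hom ?Z G" "inj_on f (carrier ?Z)"
    using int_pow_embedding[OF c] by (simp_all add: f_def)
  interpret f: group_hom ?Z G f
    using f(1) group_axioms by (simp add: group_hom_def group_hom_axioms_def)
  note C = f.img_is_subgroup
  have "c = f 1" using c by (simp add: f_def)
  then have cC: "c \<in> f ` carrier ?Z" by simp
  have sq: "\<forall>x \<in> carrier G - f ` carrier ?Z. x \<otimes> x = \<one>"
  proof
    fix x assume x: "x \<in> carrier G - f ` carrier ?Z"
    have "inv c \<in> f ` carrier ?Z" using C cC by (rule subgroup.m_inv_closed)
    then have "x \<noteq> c" "x \<noteq> inv c" using x cC by auto
    have "ord x \<noteq> 4"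
    proof
      assume "ord x = 4"
      then have "{x, c, inv c} \<subseteq> {x \<in> carrier G. ord x = 4}" using x c by auto
      moreover have "card {x, c, inv c} = 3"
        using \<open>x \<noteq> c\<close> \<open>x \<noteq> inv c\<close> inv_ne_of_ord_gt_2[of c] c by auto
      ultimately show False using card fin card_mono[of "{x \<in> carrier G. ord x = 4}" "{x, c, inv c}"] by simp
    qed
    then have "x [^] (2::nat) = \<one>" using ords[of x] x pow_eq_id[of x 2] by auto
    then show "x \<otimes> x = \<one>" using x by (simp add: numeral_2_eq_2)
  qed
  have cc: "c \<otimes> c \<noteq> \<one>" using square_of_ord_4(2)[OF c] by auto
  show ?thesis
  proof (cases "carrier G \<subseteq> f ` carrier ?Z")
    case True
    then show ?thesis using is_iso_of_embedding[OF group_integer_mod_group f] by blast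
  next
    case False
    then obtain t where "t \<in> carrier G" "t \<notin> f ` carrier ?Z" by blast
    then have "G \<cong> dihedral_group 4"
      unfolding dihedral_group_eq
      using iso_of_involution_complement[OF abelian_integer_mod_group f sq _ _ cC cc] by blast
    then show ?thesis ..
  qed
qed

text \<open>
  Since there is only one cyclic subgroup of order 4, conjugation by \<open>a\<close> maps \<open>c\<close> to itself or to its inverse;
  the latter is impossible because the cube of \<open>a\<close> is trivial. So \<open>a\<close> and \<open>c\<close> commute and their product has
  order 12.
\<close>

lemma exists_ord_ge_5_of_ord_3_4:
  assumes fin: "finite (carrier G)" and card: "card {x \<in> carrier G. ord x = 4} \<le> 2"
    and c: "c \<in> carrier G" "ord c = 4" and a: "a \<in> carrier G" "ord a = 3"
  shows "\<exists>x \<in> carrier G. 5 \<le> ord x"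
proof -
  let ?d = "a \<otimes> c \<otimes> inv a"
  have aaa: "a \<otimes> a \<otimes> a = \<one>" using pow_ord_eq_1[OF a(1)] a by (simp add: numeral_3_eq_3)
  note s = cube_one_simps[OF a(1) aaa] inv_cancel_left m_assoc
  have cc: "inv c \<noteq> c" using inv_ne_of_ord_gt_2 c by simp
  have "?d [^] n = a \<otimes> c [^] n \<otimes> inv a" for n :: nat
    using a c by (induction n) (simp_all add: m_assoc inv_cancel_left)
  moreover have "a \<otimes> x \<otimes> inv a = \<one> \<longleftrightarrow> x = \<one>" if "x \<in> carrier G" for x
    using that a by (metis inv_closed inv_solve_right' l_cancel_one' m_closed one_closed r_cancel_one' r_inv r_one l_one m_assoc)
  ultimately have "ord ?d = 4"
    using a c by (simp add: ord_unique[of ?d 4] pow_eq_id)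
  have d: "?d = c \<or> ?d = inv c"
  proof (rule ccontr)
    assume "\<not> (?d = c \<or> ?d = inv c)"
    then have "card {?d, c, inv c} = 3" using cc by auto
    moreover have "{?d, c, inv c} \<subseteq> {x \<in> carrier G. ord x = 4}" using a c \<open>ord ?d = 4\<close> by auto
    ultimately show False using card fin card_mono[of "{x \<in> carrier G. ord x = 4}" "{?d, c, inv c}"] by simp
  qed
  have "?d \<noteq> inv c"
  proof
    assume eq: "?d = inv c"
    have "inv ?d = a \<otimes> inv c \<otimes> inv a" using a c by (simp add: inv_mult_group m_assoc)
    then have eq': "a \<otimes> inv c \<otimes> inv a = c" using eq c by simp
    have "a \<otimes> (a \<otimes> ?d \<otimes> inv a) \<otimes> inv a = c" using a c by (simp add: s)
    then show False using eq eq' cc by simp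
  qed
  then have "?d = c" using d by blast
  then have "?d \<otimes> a = c \<otimes> a" by simp
  then have comm: "a \<otimes> c = c \<otimes> a" using a c by (simp add: m_assoc)
  have pow: "(a \<otimes> c) [^] n = a [^] n \<otimes> c [^] n" for n :: nat
    by (rule pow_mult_distrib[OF comm a(1) c(1)])
  have "(a \<otimes> c) [^] (3::nat) \<noteq> \<one>" "(a \<otimes> c) [^] (4::nat) \<noteq> \<one>"
  proof -
    have "a [^] (3::nat) = \<one>" "c [^] (4::nat) = \<one>" "c [^] (3::nat) \<noteq> \<one>" "a [^] (4::nat) \<noteq> \<one>"
      using pow_eq_id[OF a(1)] pow_eq_id[OF c(1)] a c by auto
    then show "(a \<otimes> c) [^] (3::nat) \<noteq> \<one>" "(a \<otimes> c) [^] (4::nat) \<noteq> \<one>"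
      using a c by (simp_all add: pow)
  qed
  then have "\<not> ord (a \<otimes> c) dvd 3" "\<not> ord (a \<otimes> c) dvd 4"
    using pow_eq_id[of "a \<otimes> c"] a c by auto
  moreover have "ord (a \<otimes> c) \<noteq> 0"
    using ord_ge_1[OF fin, of "a \<otimes> c"] a c by simp
  ultimately have "ord (a \<otimes> c) \<notin> {0, 1, 2, 3, 4}" by auto
  then have "5 \<le> ord (a \<otimes> c)" by auto
  then show ?thesis using a c by blast
qed

end

section \<open>The symmetric and alternating groups of small degree\<close>

lemma (in group) iso_dihedral_group_3:
  assumes card: "card (carrier G) = 6" and a: "a \<in> carrier G" "a \<otimes> a \<otimes> a = \<one>" "a \<noteq> \<one>"
    and t: "t \<in> carrier G" "t \<otimes> t = \<one>" "t \<noteq> \<one>" and inverts: "t \<otimes> a \<otimes> t = inv a"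
  shows "G \<cong> dihedral_group 3"
proof -
  let ?Z = "integer_mod_group 3" and ?f = "\<lambda>i::int. a [^] i"
  have "ord a = 3" using a cube_roots_eq by (auto simp: cube_roots_def)
  then have f: "?f \<in> hom ?Z G" "inj_on ?f (carrier ?Z)" "?f ` carrier ?Z = {\<one>, a, inv a}"
    using int_pow_embedding[of a 3] int_pow_image_Z3[of a] a by simp_all
  note s = cube_one_simps[OF a(1,2)] m_assoc inv_cancel_left
  have tt: "t \<otimes> (t \<otimes> x) = x" if "x \<in> carrier G" for x using t that by (simp flip: m_assoc)
  have ta: "t \<otimes> a = inv a \<otimes> t"
  proof -
    have "t \<otimes> a \<otimes> t \<otimes> t = inv a \<otimes> t" using inverts by simp
    then show ?thesis using t a by (simp add: m_assoc)
  qed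
  have ta': "t \<otimes> inv a = a \<otimes> t"
  proof -
    have "a \<otimes> (t \<otimes> a) \<otimes> inv a = a \<otimes> (inv a \<otimes> t) \<otimes> inv a" using ta by simp
    then show ?thesis using t a by (simp add: s)
  qed
  have "t \<notin> {\<one>, a, inv a}"
  proof
    assume "t \<in> {\<one>, a, inv a}"
    then have "a \<otimes> a = \<one> \<or> inv a \<otimes> inv a = \<one>" using t by auto
    then show False using a cube_one_simps[OF a(1,2)] by (auto simp: inv_eq_1_iff)
  qed
  moreover have "\<forall>n \<in> carrier ?Z. t \<otimes> ?f n = inv (?f n) \<otimes> t"
  proof
    fix n assume "n \<in> carrier ?Z"
    then have "?f n \<in> {\<one>, a, inv a}" using f(3) by blast
    then show "t \<otimes> ?f n = inv (?f n) \<otimes> t" using ta ta' t a by auto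
  qed
  ultimately obtain F where F: "F \<in> hom (dihedral_group 3) G" "inj_on F (carrier ?Z \<times> {0, 1})"
    unfolding dihedral_group_eq
    using inversion_semidirect_embedding[OF abelian_integer_mod_group f(1,2) t(1) _ t(2)] f(3) by auto
  let ?D = "carrier (dihedral_group 3)"
  have D: "?D = carrier ?Z \<times> {0, 1}" by (simp add: dihedral_group_eq carrier_Z2)
  have "F ` ?D = carrier G"
  proof (rule card_seteq)
    show "finite (carrier G)" using card by (simp add: card_ge_0_finite)
    show "F ` ?D \<subseteq> carrier G" using F(1) by (auto simp: hom_def)
    show "card (carrier G) \<le> card (F ` ?D)"
      using F(2) card card_Z3 by (simp add: D card_image card_cartesian_product)
  qed
  moreover have "group (dihedral_group 3)"
    unfolding dihedral_group_eq
    by (intro group_semidirect_product group_integer_mod_group comm_group.inversion_action_hom abelian_integer_mod_group)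
  ultimately show ?thesis using F D by (intro is_iso_of_embedding[of _ F]) auto
qed

lemma sym_group_3_iso: "sym_group 3 \<cong> dihedral_group 3"
proof -
  interpret S: group "sym_group 3" by (rule sym_group_is_group)
  define a :: "nat \<Rightarrow> nat" where "a = transpose 1 2 \<circ> transpose 2 3"
  define t :: "nat \<Rightarrow> nat" where "t = transpose 1 2"
  have perm: "a permutes {1..3}" "t permutes {1..3}"
    unfolding a_def t_def by (intro permutes_compose permutes_swap_id; simp)+
  have a_app: "a x = (if x = 1 then 2 else if x = 2 then 3 else if x = 3 then 1 else x)" for x
    by (simp add: a_def transpose_def)
  have t_app: "t x = (if x = 1 then 2 else if x = 2 then 1 else x)" for x
    by (simp add: t_def transpose_def)
  have a: "a \<circ> a \<circ> a = id" and t: "t \<circ> t = id"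
    by (rule ext, simp add: a_app t_app)+
  have "a 1 \<noteq> 1" "t 1 \<noteq> 1" by (simp_all add: a_app t_app)
  then have ne: "a \<noteq> id" "t \<noteq> id" by auto
  have "t \<circ> a \<circ> t \<circ> a = id"
    by (rule ext) (simp add: a_app t_app)
  then have "t \<otimes>\<^bsub>sym_group 3\<^esub> a \<otimes>\<^bsub>sym_group 3\<^esub> t = inv\<^bsub>sym_group 3\<^esub> a"
    using perm by (intro S.inv_equality[symmetric])
      (simp_all add: sym_group_carrier sym_group_mult sym_group_one permutes_compose)
  then show ?thesis
    using perm a t ne by (intro S.iso_dihedral_group_3[of a t])
      (simp_all add: sym_group_card_carrier sym_group_carrier sym_group_mult sym_group_one fact_numeral)
qed

text \<open>
  The 3-cycles \<open>a = (1 2 3)\<close> and \<open>b = (2 3 4)\<close> have the product \<open>(1 2)(3 4)\<close>.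
\<close>

lemma alt_group_4_iso:
  "alt_group 4 \<cong> semidirect_product klein_four (integer_mod_group 3) klein_rotation"
proof -
  interpret A: group "alt_group 4" by (rule alt_group_is_group)
  let ?S = "semidirect_product klein_four (integer_mod_group 3) klein_rotation"
  define a b :: "nat \<Rightarrow> nat" where "a = transpose 1 2 \<circ> transpose 2 3" and "b = transpose 2 3 \<circ> transpose 3 4"
  have a_app: "a x = (if x = 1 then 2 else if x = 2 then 3 else if x = 3 then 1 else x)"
    and b_app: "b x = (if x = 2 then 3 else if x = 3 then 4 else if x = 4 then 2 else x)" for x
    by (simp_all add: a_def b_def transpose_def)
  have perm: "a permutes {1..4}" "b permutes {1..4}" "evenperm a" "evenperm b"
    unfolding a_def b_def
    by (intro permutes_compose permutes_swap_id; simp)+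
      (simp_all add: evenperm_comp permutation_swap_id evenperm_swap)
  have rel: "a \<circ> a \<circ> a = id" "b \<circ> b \<circ> b = id" "(a \<circ> b) \<circ> (a \<circ> b) = id"
    by (rule ext, simp add: a_app b_app)+
  have "(a \<circ> b) 1 \<noteq> (b \<circ> a) 1" by (simp add: a_app b_app)
  then have "a \<circ> b \<noteq> b \<circ> a" by metis
  then obtain F where F: "F \<in> hom ?S (alt_group 4)" "inj_on F (carrier ?S)"
    using perm rel A.alt4_presentation_embedding[of a b]
    by (auto simp: alt_group_carrier alt_group_mult alt_group_one)
  have card: "card (carrier (alt_group 4)) = 12"
    using alt_group_card_carrier[of 4] by (simp add: fact_numeral)
  have "F ` carrier ?S = carrier (alt_group 4)"
  proof (rule card_seteq)
    show "finite (carrier (alt_group 4))" using card by (simp add: card_ge_0_finite)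
    show "F ` carrier ?S \<subseteq> carrier (alt_group 4)" using F(1) by (auto simp: hom_def)
    show "card (carrier (alt_group 4)) \<le> card (F ` carrier ?S)"
      using card card_image[OF F(2)] by (simp add: card_cartesian_product carrier_Z2 card_Z3)
  qed
  then show ?thesis
    using F by (intro A.is_iso_of_embedding group_semidirect_product group_klein_four
        group_integer_mod_group klein_rotation_hom) auto
qed

section \<open>Counting elements of order three and four\<close>

text \<open>
  The hypothesis \<open>K_out\<close> says that no element outside \<open>K\<close> has order \<open>n\<close>, in terms of single powers, which
  can be computed directly in a concrete group.
\<close>

lemma (in group) card_of_order_le_of_iso:
  assumes S: "group S" and iso: "G \<cong> S" and K: "finite K"
    and K_out: "\<And>y. y \<in> carrier S - K \<Longrightarrow>
      y [^]\<^bsub>S\<^esub> n \<noteq> \<one>\<^bsub>S\<^esub> \<or> (\<exists>m::nat. y [^]\<^bsub>S\<^esub> m = \<one>\<^bsub>S\<^esub> \<and> \<not> n dvd m)"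
  shows "card {x \<in> carrier G. ord x = n} \<le> card K"
proof -
  obtain h where h: "h \<in> hom G S" "inj_on h (carrier G)" using iso by (auto simp: is_iso_def iso_iff)
  interpret h: group_hom G S h using S h(1) group_axioms by (simp add: group_hom_def group_hom_axioms_def)
  have "h x \<in> K" if x: "x \<in> carrier G" "ord x = n" for x
  proof (rule ccontr)
    assume "h x \<notin> K"
    moreover have "h x [^]\<^bsub>S\<^esub> m = \<one>\<^bsub>S\<^esub> \<longleftrightarrow> n dvd m" for m :: nat
    proof -
      have "h x [^]\<^bsub>S\<^esub> m = h (x [^] m)" using x by (simp add: h.hom_nat_pow)
      then show ?thesis using x pow_eq_id[of x m] h(2) h.hom_one by (metis h.inj_on_one_iff nat_pow_closed)
    qed
    ultimately show False using K_out[of "h x"] x by auto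
  qed
  then have "h ` {x \<in> carrier G. ord x = n} \<subseteq> K" by blast
  moreover have "inj_on h {x \<in> carrier G. ord x = n}" using h(2) by (rule inj_on_subset) auto
  ultimately show ?thesis using K by (metis card_inj_on_le)
qed

lemma (in group) card_ord_3_le_Z3_Z3_Z2:
  assumes "is_semidirect_product G (integer_mod_group 3 \<times>\<times> integer_mod_group 3) (integer_mod_group 2)"
  shows "card {x \<in> carrier G. ord x = 3} \<le> 8"
proof -
  let ?N = "integer_mod_group 3 \<times>\<times> integer_mod_group 3"
  obtain \<phi> where \<phi>: "\<phi> \<in> hom (integer_mod_group 2) (AutoGroup ?N)"
    and iso: "G \<cong> semidirect_product ?N (integer_mod_group 2) \<phi>"
    using assms by (auto simp: is_semidirect_product_def)
  let ?S = "semidirect_product ?N (integer_mod_group 2) \<phi>"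
  have S: "group ?S"
    by (intro group_semidirect_product DirProd_group group_integer_mod_group \<phi>)
  interpret S: group ?S by (fact S)
  let ?K = "(carrier ?N \<times> {0}) - {\<one>\<^bsub>?S\<^esub>}"
  have "card {x \<in> carrier G. ord x = 3} \<le> card ?K"
  proof (rule card_of_order_le_of_iso[OF S iso])
    show "finite ?K" by (simp add: carrier_Z3)
    fix y assume y: "y \<in> carrier ?S - ?K"
    show "y [^]\<^bsub>?S\<^esub> (3::nat) \<noteq> \<one>\<^bsub>?S\<^esub> \<or> (\<exists>m::nat. y [^]\<^bsub>?S\<^esub> m = \<one>\<^bsub>?S\<^esub> \<and> \<not> 3 dvd m)"
    proof (cases "y = \<one>\<^bsub>?S\<^esub>")
      case True
      then have "y [^]\<^bsub>?S\<^esub> (1::nat) = \<one>\<^bsub>?S\<^esub>" by (simp only: S.nat_pow_one)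
      then show ?thesis by (intro disjI2 exI[of _ 1] conjI) simp_all
    next
      case False
      with y obtain n where n: "y = (n, 1)" by (auto simp: carrier_Z2)
      then show ?thesis
        by (cases "\<phi> 1 n"; cases n) (auto simp: numeral_3_eq_3 split_paired_all)
    qed
  qed
  also have "\<dots> = 8" by (simp add: card_Diff_subset card_cartesian_product card_Z3 carrier_Z3)
  finally show ?thesis .
qed

lemma (in group) card_ord_3_le_alt4:
  assumes "is_semidirect_product G klein_four (integer_mod_group 3)"
  shows "card {x \<in> carrier G. ord x = 3} \<le> 8"
proof -
  obtain \<phi> where \<phi>: "\<phi> \<in> hom (integer_mod_group 3) (AutoGroup klein_four)"
    and iso: "G \<cong> semidirect_product klein_four (integer_mod_group 3) \<phi>"
    using assms by (auto simp: is_semidirect_product_def)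
  let ?S = "semidirect_product klein_four (integer_mod_group 3) \<phi>"
  have S: "group ?S"
    by (intro group_semidirect_product group_klein_four group_integer_mod_group \<phi>)
  interpret S: group ?S by (fact S)
  let ?K = "carrier klein_four \<times> {1, 2 :: int}"
  have "card {x \<in> carrier G. ord x = 3} \<le> card ?K"
  proof (rule card_of_order_le_of_iso[OF S iso])
    show "finite ?K" by (simp add: carrier_Z2)
    fix y assume y: "y \<in> carrier ?S - ?K"
    then obtain v where v: "y = (v, 0)" "v \<in> carrier klein_four" by (auto simp: carrier_Z3)
    have "\<phi> 0 v = v"
      using hom_AutoGroup_one[OF \<phi> group_integer_mod_group group_klein_four v(2)] by simp
    moreover have "v \<otimes>\<^bsub>klein_four\<^esub> v = (0, 0)"
      using v(2) by (auto simp: carrier_klein_four simp del: carrier_DirProd)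
    ultimately have "y [^]\<^bsub>?S\<^esub> (2::nat) = \<one>\<^bsub>?S\<^esub>"
      using v S.l_one[of y] by (simp add: numeral_2_eq_2)
    then show "y [^]\<^bsub>?S\<^esub> (3::nat) \<noteq> \<one>\<^bsub>?S\<^esub> \<or> (\<exists>m::nat. y [^]\<^bsub>?S\<^esub> m = \<one>\<^bsub>?S\<^esub> \<and> \<not> 3 dvd m)"
      by (intro disjI2 exI[of _ 2]) simp
  qed
  also have "\<dots> = 8" by (simp add: card_cartesian_product carrier_Z2)
  finally show ?thesis .
qed

lemma carrier_Z4: "carrier (integer_mod_group 4) = {0, 1, 2, 3}"
  by (auto simp: carrier_integer_mod_group)

lemma (in group) card_ord_4_le_Z4:
  assumes iso: "G \<cong> integer_mod_group 4" shows "card {x \<in> carrier G. ord x = 4} \<le> 2"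
proof -
  have "card {x \<in> carrier G. ord x = 4} \<le> card {1, 3 :: int}"
  proof (rule card_of_order_le_of_iso[OF group_integer_mod_group iso])
    fix y assume "y \<in> carrier (integer_mod_group 4) - {1, 3}"
    then have "y [^]\<^bsub>integer_mod_group 4\<^esub> (2::nat) = \<one>\<^bsub>integer_mod_group 4\<^esub>"
      by (auto simp: carrier_Z4)
    then show "y [^]\<^bsub>integer_mod_group 4\<^esub> (4::nat) \<noteq> \<one>\<^bsub>integer_mod_group 4\<^esub> \<or>
        (\<exists>m::nat. y [^]\<^bsub>integer_mod_group 4\<^esub> m = \<one>\<^bsub>integer_mod_group 4\<^esub> \<and> \<not> 4 dvd m)"
      by (intro disjI2 exI[of _ 2]) simp
  qed simp
  then show ?thesis by simp
qed

lemma (in group) card_ord_4_le_dihedral_4: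
  assumes iso: "G \<cong> dihedral_group 4" shows "card {x \<in> carrier G. ord x = 4} \<le> 2"
proof -
  let ?S = "dihedral_group 4"
  have S: "group ?S"
    unfolding dihedral_group_eq
    by (intro group_semidirect_product group_integer_mod_group comm_group.inversion_action_hom abelian_integer_mod_group)
  interpret S: group ?S by (fact S)
  have "card {x \<in> carrier G. ord x = 4} \<le> card {(1, 0), (3, 0) :: int \<times> int}"
  proof (rule card_of_order_le_of_iso[OF S iso])
    fix y assume y: "y \<in> carrier ?S - {(1, 0), (3, 0)}"
    then have "y \<in> {(0, 0), (2, 0), (0, 1), (1, 1), (2, 1), (3, 1)}"
      by (auto simp: dihedral_group_eq carrier_Z4 carrier_Z2)
    then have "y \<otimes>\<^bsub>?S\<^esub> y = \<one>\<^bsub>?S\<^esub>"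
      by (auto simp: dihedral_group_eq inversion_action_def carrier_Z4)
    then have "y [^]\<^bsub>?S\<^esub> (2::nat) = \<one>\<^bsub>?S\<^esub>"
      using S.l_one[of y] y by (simp add: numeral_2_eq_2)
    then show "y [^]\<^bsub>?S\<^esub> (4::nat) \<noteq> \<one>\<^bsub>?S\<^esub> \<or> (\<exists>m::nat. y [^]\<^bsub>?S\<^esub> m = \<one>\<^bsub>?S\<^esub> \<and> \<not> 4 dvd m)"
      by (intro disjI2 exI[of _ 2]) simp
  qed simp
  then show ?thesis by simp
qed

section \<open>Groups with fewer than 125 spanning trees\<close>

lemma (in group) elementary_abelian_2I:
  assumes "\<And>x. x \<in> carrier G \<Longrightarrow> ord x \<in> {1, 2}"
  shows "elementary_abelian 2 G"
proof -
  have sq: "inv x = x" if "x \<in> carrier G" for x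
  proof -
    have "x [^] (2::nat) = \<one>" using assms[OF that] that pow_eq_id[of x 2] by auto
    then show ?thesis using that by (intro inv_equality) (simp_all add: numeral_2_eq_2)
  qed
  have "x \<otimes> y = y \<otimes> x" if "x \<in> carrier G" "y \<in> carrier G" for x y
    using sq[of "x \<otimes> y"] sq[OF that(1)] sq[OF that(2)] that by (simp add: inv_mult_group)
  then have "comm_group G" by (rule group_comm_groupI)
  then show ?thesis using assms ord_eq_1 by (auto simp: elementary_abelian_def)
qed

theorem theorem6p1:
  fixes G :: "('a, 'b) monoid_scheme"
  assumes "group G" and "finite (carrier G)" and "\<not> trivial_group G"
  shows "\<kappa> G < 5 ^ 3 \<longleftrightarrow>
     (\<omega> G = {1, 2} \<and> elementary_abelian 2 G) \<or>
     (\<omega> G = {1, 3} \<and>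
        (G \<cong> integer_mod_group 3 \<or>
         G \<cong> integer_mod_group 3 \<times>\<times> integer_mod_group 3)) \<or>
     (\<omega> G = {1, 2, 3} \<and>
        ((G \<cong> sym_group 3 \<and>
            is_semidirect_product (sym_group 3) (integer_mod_group 3) (integer_mod_group 2)) \<or>
         is_semidirect_product G
           (integer_mod_group 3 \<times>\<times> integer_mod_group 3) (integer_mod_group 2) \<or>
         (G \<cong> alt_group 4 \<and>
            is_semidirect_product (alt_group 4)
              (integer_mod_group 2 \<times>\<times> integer_mod_group 2) (integer_mod_group 3)))) \<or>
     (\<omega> G = {1, 2, 4} \<and>
        (G \<cong> integer_mod_group 4 \<or> G \<cong> dihedral_group 4))"
    (is "_ \<longleftrightarrow> ?A \<or> ?B \<or> ?C \<or> ?D")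
proof -
  interpret group G by (fact assms(1))
  note fin = assms(2)
  have ord_\<omega>: "ord x \<in> \<omega> G" if "x \<in> carrier G" for x using that by (simp add: \<omega>_def)
  have one_\<omega>: "1 \<in> \<omega> G" using ord_\<omega>[of "\<one>\<^bsub>G\<^esub>"] by simp
  have sym3: "is_semidirect_product (sym_group 3) (integer_mod_group 3) (integer_mod_group 2)"
    unfolding is_semidirect_product_def
    using sym_group_3_iso comm_group.inversion_action_hom[OF abelian_integer_mod_group]
    by (auto simp: dihedral_group_eq)
  have alt4: "is_semidirect_product (alt_group 4) klein_four (integer_mod_group 3)"
    unfolding is_semidirect_product_def using alt_group_4_iso klein_rotation_hom by blast
  have "?A \<or> ?B \<or> ?C \<or> ?D" if less: "\<kappa> G < 5 ^ 3"
  proof -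
    have less': "\<not> 125 \<le> \<kappa> G" using less by simp
    have ords: "ord x \<in> {1, 2, 3, 4}" if "x \<in> carrier G" for x
    proof -
      have "1 \<le> ord x" "\<not> 5 \<le> ord x"
        using kappa_ge_of_ord_ge_5[OF fin that] ord_ge_1[OF fin that] less' by fastforce+
      then have "ord x = 1 \<or> ord x = 2 \<or> ord x = 3 \<or> ord x = 4" by linarith
      then show ?thesis by simp
    qed
    have card4: "card {x \<in> carrier G. ord x = 4} \<le> 2" using kappa_ge_two_cyclic_4[OF fin] less' by fastforce
    have card3: "card {x \<in> carrier G. ord x = 3} \<le> 8" using kappa_ge_five_cyclic_3[OF fin] less' by fastforce
    show ?thesis
    proof (cases "4 \<in> \<omega> G")
      case True
      then obtain c where c: "c \<in> carrier G" "ord c = 4" by (auto simp: \<omega>_def)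
      have ords': "ord x \<in> {1, 2, 4}" if "x \<in> carrier G" for x
        using ords[OF that] exists_ord_ge_5_of_ord_3_4[OF fin card4 c that] ords by fastforce
      moreover have "2 \<in> \<omega> G" using ord_\<omega> square_of_ord_4[OF c] by metis
      ultimately have "\<omega> G = {1, 2, 4}" using True one_\<omega> by (auto simp: \<omega>_def)
      then show ?thesis using structure_of_orders_124[OF ords' fin card4 c] by blast
    next
      case no4: False
      have ords': "ord x \<in> {1, 2, 3}" if "x \<in> carrier G" for x
        using ords[OF that] ord_\<omega>[OF that] no4 by auto
      show ?thesis
      proof (cases "3 \<in> \<omega> G")
        case True
        then obtain a where a: "a \<in> carrier G" "ord a = 3" by (auto simp: \<omega>_def)
        have card: "card cube_roots \<le> 9"
          unfolding cube_roots_eq using card3 card_insert_le_m1[of 9 "{x \<in> carrier G. ord x = 3}" "\<one>\<^bsub>G\<^esub>"] by simp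
        have exp: "\<forall>x \<in> carrier G - cube_roots. ord x = 2"
          using ords' ord_eq_1 unfolding cube_roots_eq by blast
        then have "\<forall>x \<in> carrier G - cube_roots. x \<otimes>\<^bsub>G\<^esub> x = \<one>\<^bsub>G\<^esub>"
          using pow_ord_eq_1 by (fastforce simp: numeral_2_eq_2)
        moreover have "a \<in> cube_roots" "a \<noteq> \<one>\<^bsub>G\<^esub>" using a by (auto simp: cube_roots_eq)
        ultimately have struct: "cube_roots = carrier G \<and>
            (G \<cong> integer_mod_group 3 \<or> G \<cong> integer_mod_group 3 \<times>\<times> integer_mod_group 3) \<or>
          cube_roots \<noteq> carrier G \<and> (G \<cong> dihedral_group 3 \<or>
             is_semidirect_product G (integer_mod_group 3 \<times>\<times> integer_mod_group 3) (integer_mod_group 2) \<or>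
             G \<cong> semidirect_product klein_four (integer_mod_group 3) klein_rotation)"
          by (rule structure_of_orders_123[OF fin card])
        show ?thesis
        proof (cases "cube_roots = carrier G")
          case all: True
          then have iso: "G \<cong> integer_mod_group 3 \<or> G \<cong> integer_mod_group 3 \<times>\<times> integer_mod_group 3"
            using struct by blast
          have "ord x \<in> {1, 3}" if "x \<in> carrier G" for x
          proof -
            have "x \<in> cube_roots" using that all by blast
            then show ?thesis unfolding cube_roots_eq by auto
          qed
          then have "\<omega> G = {1, 3}" using True one_\<omega> by (auto simp: \<omega>_def)
          then show ?thesis using iso by blast
        next
          case False
          then have iso: "G \<cong> dihedral_group 3 \<or>
             is_semidirect_product G (integer_mod_group 3 \<times>\<times> integer_mod_group 3) (integer_mod_group 2) \<or>
             G \<cong> semidirect_product klein_four (integer_mod_group 3) klein_rotation"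
            using struct by blast
          obtain t where "t \<in> carrier G - cube_roots" using False by (auto simp: cube_roots_def)
          then have "2 \<in> \<omega> G" using exp ord_\<omega> by (metis DiffD1)
          then have "\<omega> G = {1, 2, 3}" using True one_\<omega> ords' by (auto simp: \<omega>_def)
          moreover have "G \<cong> sym_group 3" if "G \<cong> dihedral_group 3"
            using that group.iso_sym[OF sym_group_is_group sym_group_3_iso] by (rule iso_trans)
          moreover have "G \<cong> alt_group 4"
            if "G \<cong> semidirect_product klein_four (integer_mod_group 3) klein_rotation"
            using that group.iso_sym[OF alt_group_is_group alt_group_4_iso] by (rule iso_trans)
          ultimately show ?thesis using iso sym3 alt4 by blast
        qed
      next
        case False
        then have ords'': "ord x \<in> {1, 2}" if "x \<in> carrier G" for x
          using ords'[OF that] ord_\<omega>[OF that] by auto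
        have "\<exists>x \<in> carrier G. x \<noteq> \<one>\<^bsub>G\<^esub>" using assms(1,3) by (auto simp: trivial_group_def)
        then have "2 \<in> \<omega> G" using ords'' ord_\<omega> ord_eq_1 by (metis insert_iff singletonD)
        then have "\<omega> G = {1, 2}" using one_\<omega> ords'' by (auto simp: \<omega>_def)
        then show ?thesis using elementary_abelian_2I[OF ords''] by blast
      qed
    qed
  qed
  moreover have "\<kappa> G < 5 ^ 3" if "?A \<or> ?B \<or> ?C \<or> ?D"
  proof -
    have small: "\<kappa> G < 5 ^ 3"
      if "\<omega> G \<subseteq> {1, 2, 3}" "card {x \<in> carrier G. ord x = 3} \<le> 8"
      using kappa_le_of_orders_123[OF fin _ that(2)] that(1) ord_\<omega> by fastforce
    have card3: "card {x \<in> carrier G. ord x = 3} \<le> 8" if "card (carrier G) \<le> 9"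
    proof -
      have "{x \<in> carrier G. ord x = 3} \<subseteq> carrier G - {\<one>\<^bsub>G\<^esub>}" by auto
      then have "card {x \<in> carrier G. ord x = 3} \<le> card (carrier G - {\<one>\<^bsub>G\<^esub>})"
        using fin by (intro card_mono) auto
      then show ?thesis using that fin by simp
    qed
    from that consider (A) ?A | (B) ?B | (C) ?C | (D) ?D by blast
    then show ?thesis
    proof cases
      case A
      then have "{x \<in> carrier G. ord x = 3} = {}" using ord_\<omega> by force
      then show ?thesis using A by (intro small) (auto simp only: card.empty)
    next
      case B
      then have "card (carrier G) \<le> 9"
        using iso_same_card[of G "integer_mod_group 3"]
          iso_same_card[of G "integer_mod_group 3 \<times>\<times> integer_mod_group 3"]
        by (auto simp: card_Z3 card_cartesian_product)
      then show ?thesis using B by (intro small card3) auto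
    next
      case C
      have "card {x \<in> carrier G. ord x = 3} \<le> 8" if "G \<cong> sym_group 3"
        using iso_same_card[OF that] by (intro card3) (simp add: sym_group_card_carrier fact_numeral)
      moreover have "card {x \<in> carrier G. ord x = 3} \<le> 8" if "G \<cong> alt_group 4"
      proof (rule card_ord_3_le_alt4)
        have "G \<cong> semidirect_product klein_four (integer_mod_group 3) klein_rotation"
          using that alt_group_4_iso by (rule iso_trans)
        then show "is_semidirect_product G klein_four (integer_mod_group 3)"
          unfolding is_semidirect_product_def using klein_rotation_hom by blast
      qed
      ultimately have "card {x \<in> carrier G. ord x = 3} \<le> 8"
        using C card_ord_3_le_Z3_Z3_Z2 by blast
      then show ?thesis using C by (intro small) auto
    next
      case D
      then have "4 \<in> \<omega> G" by auto
      then obtain c where c: "c \<in> carrier G" "ord c = 4" by (auto simp: \<omega>_def)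
      have card4: "card {x \<in> carrier G. ord x = 4} \<le> 2"
        using D card_ord_4_le_Z4 card_ord_4_le_dihedral_4 by blast
      have "ord x \<in> {1, 2, 4}" if "x \<in> carrier G" for x using ord_\<omega>[OF that] D by auto
      from kappa_le_of_orders_124[OF fin this c card4] have "\<kappa> G \<le> 64" by simp
      then show ?thesis by simp
    qed
  qed
  ultimately show ?thesis by (rule iffI)
qed

end
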